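(* Let $f\in C^1(\mathcal P_p)$ for some $p\in[1,\infty)\cup\{0\}$. Then there exist $C^1$ cylinder functions $f_n$, $n\in\mathbb N$, (with versions of their derivatives) such that $$f_n(\mu)\to f(\mu)\quad\text{and}\quad\frac{\partial f_n}{\partial\mu}(x,\mu)\to\frac{\partial f}{\partial\mu}(x,\mu)$$ for all $\mu\in\mathcal P_p$, $x\in\mathbb R^d$, and for every compact $K\subset\mathcal P_p$ there is a constant $c_K$ with $$|f_n(\mu)|\le c_K\quad\text{and}\quad\Big|\frac{\partial f_n}{\partial\mu}(x,\mu)\Big|\le c_K(1+|x|^p)$$ for all $\mu\in K$, $x\in\mathbb R^d$, $n\in\mathbb N$.
   Context: Fix $d\in\mathbb N$. $\mathcal P$ is the set of Borel probability measures on $\mathbb R^d$ (weak topology); for $p\in[1,\infty)$, $\mathcal P_p$ is the subset with finite $p$-th moment, with the Wasserstein-$p$ metric; $\mathcal P_0:=\mathcal P$; $|x|^0:=1$; $\mu(\varphi)=\int\varphi\,d\mu$. $C^1(\mathcal P_p)$ is the set of $f:\mathcal P_p\to\mathbb R$ for which there exists a continuous function $\frac{\partial f}{\partial\mu}:\mathbb R^d\times\mathcal P_p\to\mathbb R$ (a version of the derivative) such that for every compact $K\subset\mathcal P_p$ there is $c_K$ with $|\frac{\partial f}{\partial\mu}(x,\mu)|\le c_K(1+|x|^p)$ for all $x\in\mathbb R^d,\mu\in K$, and $f(\nu)-f(\mu)=\int_0^1\int_{\mathbb R^d}\frac{\partial f}{\partial\mu}(x,t\nu+(1-t)\mu)(\nu-\mu)(dx)\,dt$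 for all $\mu,\nu\in\mathcal P_p$. A $C^1$ cylinder function is $f(\mu)=\tilde f(\mu(\varphi_1),\dots,\mu(\varphi_n))$ with $n\in\mathbb N$, $\tilde f\in C^1(\mathbb R^n)$, $\varphi_i$ bounded continuous on $\mathbb R^d$; a version of its derivative is $\sum_i\partial_i\tilde f(\mu(\varphi_1),\dots,\mu(\varphi_n))\varphi_i(x)$. *)

theory Defs
  imports "HOL-Probability.Probability"
begin

text \<open>R^d is modelled by an arbitrary Euclidean space type 'a (dimension DIM('a)).
  Exponents p are reals with p = 0 or p >= 1; the convention |x|^0 = 1 is built into pw.\<close>

definition pw :: "'a::euclidean_space \<Rightarrow> real \<Rightarrow> real" where
  "pw x p = (if p = 0 then 1 else norm x powr p)"

definition Prob :: "'a::euclidean_space measure set" where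
  "Prob = {M. prob_space M \<and> sets M = sets borel}"

definition Pp :: "real \<Rightarrow> 'a::euclidean_space measure set" where
  "Pp p = {M \<in> Prob. integrable M (\<lambda>x. pw x p)}"

definition bcont :: "('a::euclidean_space \<Rightarrow> real) \<Rightarrow> bool" where
  "bcont \<phi> \<longleftrightarrow> continuous_on UNIV \<phi> \<and> bounded (range \<phi>)"

abbreviation integ :: "'a::euclidean_space measure \<Rightarrow> ('a \<Rightarrow> real) \<Rightarrow> real" where
  "integ M \<phi> \<equiv> integral\<^sup>L M \<phi>"

definition weak_conv :: "(nat \<Rightarrow> 'a::euclidean_space measure) \<Rightarrow> 'a measure \<Rightarrow> bool" where
  "weak_conv Ms M \<longleftrightarrow> (\<forall>\<phi>. bcont \<phi> \<longrightarrow> (\<lambda>n. integ (Ms n) \<phi>) \<longlonglongrightarrow> integ M \<phi>)"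

definition couplings :: "'a::euclidean_space measure \<Rightarrow> 'a measure \<Rightarrow> ('a \<times> 'a) measure set" where
  "couplings M N = {\<pi>. prob_space \<pi> \<and> sets \<pi> = sets borel \<and>
      distr \<pi> borel fst = M \<and> distr \<pi> borel snd = N}"

definition wasserstein :: "real \<Rightarrow> 'a::euclidean_space measure \<Rightarrow> 'a measure \<Rightarrow> real" where
  "wasserstein p M N =
     enn2real (INF \<pi>\<in>couplings M N. \<integral>\<^sup>+ z. ennreal (dist (fst z) (snd z) powr p) \<partial>\<pi>) powr (1 / p)"

definition Pconv :: "real \<Rightarrow> (nat \<Rightarrow> 'a::euclidean_space measure) \<Rightarrow> 'a measure \<Rightarrow> bool" where
  "Pconv p Ms M \<longleftrightarrow> (\<forall>n. Ms n \<in> Pp p) \<and> M \<in> Pp p \<and>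
     (if p = 0 then weak_conv Ms M else (\<lambda>n. wasserstein p (Ms n) M) \<longlonglongrightarrow> 0)"

text \<open>Compact subsets of P_p (the space is metrizable, so compact = sequentially compact).\<close>
definition Pcompact :: "real \<Rightarrow> 'a::euclidean_space measure set \<Rightarrow> bool" where
  "Pcompact p K \<longleftrightarrow> K \<subseteq> Pp p \<and>
     (\<forall>Ms. (\<forall>n. Ms n \<in> K) \<longrightarrow> (\<exists>(r::nat \<Rightarrow> nat) M. strict_mono r \<and> M \<in> K \<and> Pconv p (Ms \<circ> r) M))"

definition mix :: "real \<Rightarrow> 'a::euclidean_space measure \<Rightarrow> 'a measure \<Rightarrow> 'a measure" where
  "mix t N M = measure_of UNIV (sets borel)
     (\<lambda>A. ennreal t * emeasure N A + ennreal (1 - t) * emeasure M A)"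

text \<open>D is a version of the derivative of f in the sense of C^1(P_p);
  continuity on R^d x P_p is sequential continuity (product of metrizable spaces).\<close>
definition C1_version :: "real \<Rightarrow> ('a::euclidean_space measure \<Rightarrow> real)
    \<Rightarrow> ('a \<Rightarrow> 'a measure \<Rightarrow> real) \<Rightarrow> bool" where
  "C1_version p f D \<longleftrightarrow>
     (\<forall>xs x Ms M. xs \<longlonglongrightarrow> x \<longrightarrow> Pconv p Ms M \<longrightarrow> (\<lambda>n. D (xs n) (Ms n)) \<longlonglongrightarrow> D x M) \<and>
     (\<forall>K. Pcompact p K \<longrightarrow> (\<exists>c. \<forall>x. \<forall>M\<in>K. \<bar>D x M\<bar> \<le> c * (1 + pw x p))) \<and>
     (\<forall>M\<in>Pp p. \<forall>N\<in>Pp p. f N - f M =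
        (LBINT t=0..1. integ N (\<lambda>x. D x (mix t N M)) - integ M (\<lambda>x. D x (mix t N M))))"

definition C1 :: "real \<Rightarrow> ('a::euclidean_space measure \<Rightarrow> real) \<Rightarrow> bool" where
  "C1 p f \<longleftrightarrow> (\<exists>D. C1_version p f D)"

text \<open>R^n is coded as functions nat => real vanishing from index n on
  (with the product topology this is the Euclidean topology).
  F is C^1 on R^n with partial derivatives DF i (i < n), continuous on R^n.\<close>
definition Rn :: "nat \<Rightarrow> (nat \<Rightarrow> real) set" where
  "Rn n = {v. \<forall>i\<ge>n. v i = 0}"

definition C1_Rn :: "nat \<Rightarrow> ((nat \<Rightarrow> real) \<Rightarrow> real) \<Rightarrow> (nat \<Rightarrow> (nat \<Rightarrow> real) \<Rightarrow> real) \<Rightarrow> bool" where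
  "C1_Rn n F DF \<longleftrightarrow>
     (\<forall>i<n. continuous_on (Rn n) (DF i)) \<and>
     (\<forall>i<n. \<forall>v\<in>Rn n. ((\<lambda>t. F (v(i := v i + t))) has_real_derivative DF i v) (at 0))"

definition cylinder :: "('a::euclidean_space measure \<Rightarrow> real) \<Rightarrow> ('a \<Rightarrow> 'a measure \<Rightarrow> real) \<Rightarrow> bool" where
  "cylinder g Dg \<longleftrightarrow> (\<exists>n::nat. \<exists>F DF \<phi>. n \<ge> 1 \<and> C1_Rn n F DF \<and> (\<forall>i<n. bcont (\<phi> i)) \<and>
     (\<forall>M. g M = F (\<lambda>i. if i < n then integ M (\<phi> i) else 0)) \<and>
     (\<forall>x M. Dg x M = (\<Sum>i<n. DF i (\<lambda>j. if j < n then integ M (\<phi> j) else 0) * \<phi> i x)))"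

end

theory Submission
  imports Defs
begin

text \<open>
  Let psi_i be a fine partition of unity with associated points x_i. Replacing M by its quantization
  T M = SUM_i M(psi_i) delta_{x_i} makes f a function of finitely many integrals, whose derivative at x is
  SUM_i psi_i(x) D(x_i, T M). As the partitions are refined, T M converges to M in P_p, and the
  quantizations of a compact set stay in a compact set, which gives the limits and the bounds.

  Two points need care. First, the weights M(psi_i) only range over a simplex, on which f determines the
  gradient up to a common constant. If all psi_i are bounded below, the weights avoid the boundary of the simplex,
  so clipping them smoothly to positive numbers and normalizing extends the function to R^n. This extension has
  the centred derivative D(x_i, T M) - (T M)(D(., T M)); the missing constant is restored by adding
  (SUM_i v_i - 1) c(v), where c is a C^1 approximation of v |-> (T M)(D(., T M)).
  Secondly, Wasserstein convergence is replaced throughout by convergence of the integrals of all continuous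
  functions bounded by a multiple of 1 + |x|^p.
\<close>

section \<open>Test functions of growth p and mixtures\<close>

text \<open>The increment formula tests \<open>D\<close> only against differences of probability
  measures, so it cannot tell \<open>D x M\<close> from \<open>D x M + k M\<close>. A construction
  that used \<open>f\<close> alone could recover only a centred derivative, whereas the claim
  concerns the given version. The correcting factor must be differentiable, but the mean of
  \<open>D\<close> is merely continuous in the weights. Since the other factor vanishes at every
  weight vector, only values of the correction enter the derivative there, so uniform approximation
  on the unit cube, without control of gradients, is enough.

  Integrals of growth-\<open>p\<close> functions are convenient because they are affine under mixing
  and because quantization can be moved from the measure to the test function. The metric is then
  needed only in one equivalence, proved with a coupling built from the same partitions of unity.
  Bounds uniform over a compact set and over all levels come from sequences: violating measures and
  levels have a subsequence with convergent quantizations, whether the levels repeat or tend to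
  infinity.\<close>

definition pgrowth :: "real \<Rightarrow> ('a::euclidean_space \<Rightarrow> real) \<Rightarrow> bool" where
  "pgrowth p \<phi> \<longleftrightarrow> continuous_on UNIV \<phi> \<and> (\<exists>C. \<forall>x. \<bar>\<phi> x\<bar> \<le> C * (1 + pw x p))"

text \<open>One notion for both topologies: for \<open>p = 0\<close> the test functions are exactly
  the bounded continuous ones, and for \<open>p \<ge> 1\<close> this is Wasserstein convergence on
  \<open>Pp p\<close>. Both identifications are made in \<open>Pconv_iff_pweak\<close>.\<close>

definition pweak :: "real \<Rightarrow> (nat \<Rightarrow> 'a::euclidean_space measure) \<Rightarrow> 'a measure \<Rightarrow> bool" where
  "pweak p Ms M \<longleftrightarrow> (\<forall>\<phi>. pgrowth p \<phi> \<longrightarrow> (\<lambda>n. integ (Ms n) \<phi>) \<longlonglongrightarrow> integ M \<phi>)"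

lemma pw_nonneg [simp]: "0 \<le> pw x p"
  by (simp add: pw_def)

lemma pw_minus [simp]: "pw (- x) p = pw x p"
  by (simp add: pw_def)

lemma one_plus_pw_pos [simp]: "0 < 1 + pw x p"
  using pw_nonneg[of x p] by linarith

lemma continuous_on_pw:
  assumes "p = 0 \<or> p \<ge> 1"
  shows "continuous_on UNIV (\<lambda>x::'a::euclidean_space. pw x p)"
proof (cases "p = 0")
  case False
  have "continuous_on UNIV (\<lambda>x::'a. norm x powr p)"
    using assms False by (intro continuous_on_powr' continuous_intros) auto
  then show ?thesis using False by (simp add: pw_def)
qed (simp add: pw_def)

lemma pw_mono:
  assumes "p = 0 \<or> p \<ge> 1" and "norm x \<le> norm y"
  shows "pw x p \<le> pw y p"
  using assms by (auto simp: pw_def intro!: powr_mono2)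

text \<open>From \<open>a + b \<le> 2 * max a b\<close>. Convexity would give a smaller constant,
  but any constant depending on \<open>p\<close> alone is good enough below.\<close>

lemma powr_add_le:
  fixes a b p :: real
  assumes "0 \<le> a" "0 \<le> b" "0 \<le> p"
  shows "(a + b) powr p \<le> 2 powr p * (a powr p + b powr p)"
proof -
  have "(a + b) powr p \<le> (2 * max a b) powr p"
    using assms by (intro powr_mono2) auto
  also have "\<dots> = 2 powr p * max a b powr p"
    using assms by (simp add: powr_mult)
  also have "max a b powr p \<le> a powr p + b powr p"
    by (simp add: max_def)
  finally show ?thesis by simp
qed

lemma pw_add_le:
  assumes "p = 0 \<or> p \<ge> 1"
  shows "pw (x + y) p \<le> 2 powr p * (pw x p + pw y p)"
proof (cases "p = 0")
  case False
  then have "norm (x + y) powr p \<le> (norm x + norm y) powr p"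
    using assms by (intro powr_mono2) (auto simp: norm_triangle_ineq)
  also have "\<dots> \<le> 2 powr p * (norm x powr p + norm y powr p)"
    using assms by (intro powr_add_le) auto
  finally show ?thesis using False by (simp add: pw_def)
qed (simp add: pw_def)

lemma PpD:
  assumes "M \<in> Pp p"
  shows "prob_space M" "sets M = sets borel" "space M = UNIV" "integrable M (\<lambda>x. pw x p)"
  using assms sets_eq_imp_space_eq[of M borel] by (auto simp: Pp_def Prob_def)

lemma Pp_measurable:
  assumes "M \<in> Pp p" "\<phi> \<in> borel_measurable borel"
  shows "\<phi> \<in> borel_measurable M"
  using assms by (simp add: PpD(2) cong: measurable_cong_sets)

lemma Pp_integrable:
  assumes "M \<in> Pp p" "\<phi> \<in> borel_measurable borel" "\<And>x. \<bar>\<phi> x\<bar> \<le> C * (1 + pw x p)"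
  shows "integrable M (\<phi> :: 'a::euclidean_space \<Rightarrow> real)"
proof -
  interpret prob_space M using assms PpD by blast
  have "integrable M (\<lambda>x. C * (1 + pw x p))"
    using PpD(4)[OF assms(1)] by simp
  then show ?thesis
    by (rule Bochner_Integration.integrable_bound)
       (auto intro!: Pp_measurable[OF assms(1,2)] order_trans[OF assms(3)])
qed

lemma pgrowth_measurable: "pgrowth p \<phi> \<Longrightarrow> \<phi> \<in> borel_measurable borel"
  by (auto simp: pgrowth_def intro: borel_measurable_continuous_onI)

lemma pgrowth_integrable: "M \<in> Pp p \<Longrightarrow> pgrowth p \<phi> \<Longrightarrow> integrable M \<phi>"
  using Pp_integrable pgrowth_measurable unfolding pgrowth_def by blast

lemma pgrowth_pw:
  assumes "p = 0 \<or> p \<ge> 1"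
  shows "pgrowth p (\<lambda>x::'a::euclidean_space. 1 + pw x p)"
  unfolding pgrowth_def
  by (auto intro!: continuous_intros continuous_on_pw[OF assms] exI[of _ 1] simp: abs_of_pos)

lemma pgrowth_bounded_mult:
  assumes "pgrowth p \<phi>" "continuous_on UNIV \<psi>" "\<And>x. \<bar>\<psi> x\<bar> \<le> B"
  shows "pgrowth p (\<lambda>x. \<psi> x * \<phi> x)"
proof -
  obtain C where C: "\<And>x. \<bar>\<phi> x\<bar> \<le> C * (1 + pw x p)"
    using assms unfolding pgrowth_def by auto
  have "\<bar>\<psi> x * \<phi> x\<bar> \<le> (B * C) * (1 + pw x p)" for x
    using mult_mono[OF assms(3)[of x] C[of x]] assms(3)[of x] by (simp add: abs_mult mult.assoc)
  then show ?thesis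
    using assms unfolding pgrowth_def by (auto intro!: continuous_intros)
qed

lemma pgrowth_bounded:
  assumes "continuous_on UNIV \<psi>" "\<And>x. \<bar>\<psi> x\<bar> \<le> B"
  shows "pgrowth p \<psi>"
proof -
  have "\<bar>\<psi> x\<bar> \<le> B * (1 + pw x p)" for x
  proof -
    have "0 \<le> B" using assms(2)[of x] by linarith
    then have "B * 1 \<le> B * (1 + pw x p)" by (intro mult_left_mono) auto
    then show ?thesis using assms(2)[of x] by linarith
  qed
  then show ?thesis using assms(1) unfolding pgrowth_def by blast
qed

lemma pgrowth_add:
  assumes "pgrowth p \<phi>" "pgrowth p \<psi>"
  shows "pgrowth p (\<lambda>x. \<phi> x + \<psi> x)"
proof -
  obtain C C' where "\<And>x. \<bar>\<phi> x\<bar> \<le> C * (1 + pw x p)" "\<And>x. \<bar>\<psi> x\<bar> \<le> C' * (1 + pw x p)"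
    using assms unfolding pgrowth_def by auto
  then have "\<bar>\<phi> x + \<psi> x\<bar> \<le> (C + C') * (1 + pw x p)" for x
    using abs_triangle_ineq[of "\<phi> x" "\<psi> x"] by (smt (verit) distrib_right)
  then show ?thesis
    using assms unfolding pgrowth_def by (auto intro!: continuous_intros)
qed

lemma pgrowth_sum:
  assumes "finite I" "\<And>i. i \<in> I \<Longrightarrow> pgrowth p (\<phi> i)"
  shows "pgrowth p (\<lambda>x. \<Sum>i\<in>I. \<phi> i x)"
  using assms
proof (induction I rule: finite_induct)
  case empty
  then show ?case by (auto intro!: pgrowth_bounded[of _ 0])
next
  case (insert i I)
  then show ?case using pgrowth_add[of p "\<phi> i" "\<lambda>x. \<Sum>i\<in>I. \<phi> i x"] by simp
qed

lemma pgrowth_pw_shift: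
  assumes p: "p = 0 \<or> p \<ge> 1"
  shows "pgrowth p (\<lambda>x. pw (x - z) p)"
  unfolding pgrowth_def
proof (intro conjI exI allI)
  show "continuous_on UNIV (\<lambda>x. pw (x - z) p)"
    by (intro continuous_intros continuous_on_compose2[OF continuous_on_pw[OF p]]) auto
  fix x
  have "pw (x - z) p \<le> 2 powr p * (pw x p + pw (- z) p)" using pw_add_le[OF p, of x "- z"] by simp
  also have "\<dots> \<le> 2 powr p * ((1 + pw z p) * (1 + pw x p))"
    by (intro mult_left_mono) (auto simp: algebra_simps)
  finally show "\<bar>pw (x - z) p\<bar> \<le> 2 powr p * (1 + pw z p) * (1 + pw x p)" by (simp add: mult.assoc)
qed

text \<open>A continuous substitute for \<open>1 + pw x p\<close> cut off to the complement of a
  ball. Being a test function of growth \<open>p\<close>, it has integrals that converge under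
  \<open>pweak\<close>, so a small tail of the limit forces small tails along the sequence.\<close>

definition tail_weight :: "real \<Rightarrow> real \<Rightarrow> 'a::euclidean_space \<Rightarrow> real" where
  "tail_weight p R x = min 1 (max 0 (norm x - R)) * (1 + pw x p)"

lemma tail_weight_nonneg: "0 \<le> tail_weight p R x"
  by (simp add: tail_weight_def)

lemma tail_weight_le: "tail_weight p R x \<le> 1 + pw x p"
  unfolding tail_weight_def by (rule mult_left_le_one_le) auto

lemma tail_weight_ge: "norm x \<ge> R + 1 \<Longrightarrow> 1 + pw x p \<le> tail_weight p R x"
  by (simp add: tail_weight_def min_def max_def)

lemma pgrowth_tail_weight:
  assumes "p = 0 \<or> p \<ge> 1" shows "pgrowth p (tail_weight p R)"
  unfolding tail_weight_def
  by (rule pgrowth_bounded_mult[OF pgrowth_pw[OF assms], of _ 1]) (auto intro!: continuous_intros)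

lemma tail_weight_small:
  fixes M :: "'a::euclidean_space measure"
  assumes p: "p = 0 \<or> p \<ge> 1" and M: "M \<in> Pp p" and "0 < \<eta>"
  obtains R where "1 \<le> R" "integ M (tail_weight p R) < \<eta>"
proof -
  have "(\<lambda>n. integ M (tail_weight p (real n))) \<longlonglongrightarrow> integ M (\<lambda>x. 0)"
  proof (rule integral_dominated_convergence[where w = "\<lambda>x. 1 + pw x p"])
    show "integrable M (\<lambda>x. 1 + pw x p)" using pgrowth_integrable[OF M pgrowth_pw[OF p]] .
    show "tail_weight p (real n) \<in> borel_measurable M" for n
      by (intro Pp_measurable[OF M] pgrowth_measurable[OF pgrowth_tail_weight[OF p]])
    have "(\<lambda>n. tail_weight p (real n) x) \<longlonglongrightarrow> 0" for x :: 'a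
    proof (rule tendsto_eventually)
      obtain N :: nat where "norm x \<le> real N" using real_arch_simple by blast
      then show "\<forall>\<^sub>F n in sequentially. tail_weight p (real n) x = 0"
        unfolding eventually_sequentially by (intro exI[of _ N]) (auto simp: tail_weight_def)
    qed
    then show "AE x in M. (\<lambda>n. tail_weight p (real n) x) \<longlonglongrightarrow> 0" by simp
    show "AE x in M. norm (tail_weight p (real n) x) \<le> 1 + pw x p" for n
      by (auto simp: tail_weight_nonneg tail_weight_le)
  qed auto
  then have "(\<lambda>n. integ M (tail_weight p (real n))) \<longlonglongrightarrow> 0" by simp
  then have "\<forall>\<^sub>F n in sequentially. integ M (tail_weight p (real n)) < \<eta>"
    using \<open>0 < \<eta>\<close> by (rule order_tendstoD)
  then obtain N where "\<forall>n\<ge>N. integ M (tail_weight p (real n)) < \<eta>"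
    unfolding eventually_sequentially by auto
  then show thesis by (intro that[of "real (max N 1)"]) (auto simp: max_def)
qed

text \<open>Continuous convergence: u n (y n) tends to v x whenever y n tends to x.\<close>

definition cconv :: "(nat \<Rightarrow> 'a::euclidean_space \<Rightarrow> real) \<Rightarrow> ('a \<Rightarrow> real) \<Rightarrow> bool" where
  "cconv u v \<longleftrightarrow> (\<forall>x. \<forall>\<eta>>0. \<exists>\<delta>>0. \<exists>n0. \<forall>n\<ge>n0. \<forall>y. dist y x < \<delta> \<longrightarrow> \<bar>u n y - v x\<bar> < \<eta>)"

lemma cconv_const:
  assumes "continuous_on UNIV v" shows "cconv (\<lambda>n. v) v"
  unfolding cconv_def
proof (intro allI impI)
  fix x and \<eta> :: real assume "0 < \<eta>"
  then obtain \<delta> where "\<delta> > 0" "\<forall>y. dist y x < \<delta> \<longrightarrow> \<bar>v y - v x\<bar> < \<eta>"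
    using assms unfolding continuous_on_iff dist_real_def by blast
  then show "\<exists>\<delta>>0. \<exists>n0. \<forall>n\<ge>n0. \<forall>y. dist y x < \<delta> \<longrightarrow> \<bar>v y - v x\<bar> < \<eta>" by blast
qed

lemma cconv_pointwise:
  assumes "cconv u v" shows "(\<lambda>n. u n x) \<longlonglongrightarrow> v x"
proof (rule LIMSEQ_I)
  fix \<eta> :: real assume "0 < \<eta>"
  then obtain \<delta> n0 where "\<delta> > 0" "\<forall>n\<ge>n0. \<forall>y. dist y x < \<delta> \<longrightarrow> \<bar>u n y - v x\<bar> < \<eta>"
    using assms unfolding cconv_def by meson
  then show "\<exists>no. \<forall>n\<ge>no. norm (u n x - v x) < \<eta>" by (intro exI[of _ n0]) auto
qed

lemma cconv_continuous:
  assumes "cconv u v" shows "continuous_on UNIV v"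
  unfolding continuous_on_iff
proof (intro ballI allI impI)
  fix x and e :: real assume "0 < e"
  then obtain \<delta> n0 where d: "\<delta> > 0" "\<forall>n\<ge>n0. \<forall>y. dist y x < \<delta> \<longrightarrow> \<bar>u n y - v x\<bar> < e / 2"
    using assms unfolding cconv_def by (meson half_gt_zero)
  have "dist (v y) (v x) < e" if y: "dist y x < \<delta>" for y
  proof -
    have "(\<lambda>n. \<bar>u n y - v x\<bar>) \<longlonglongrightarrow> \<bar>v y - v x\<bar>"
      by (intro tendsto_intros cconv_pointwise[OF assms])
    then have "\<bar>v y - v x\<bar> \<le> e / 2"
      by (rule LIMSEQ_le_const2) (use d y in \<open>auto intro!: exI[of _ n0] less_imp_le\<close>)
    then show ?thesis using \<open>0 < e\<close> by (simp add: dist_real_def)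
  qed
  then show "\<exists>d>0. \<forall>x'\<in>UNIV. dist x' x < d \<longrightarrow> dist (v x') (v x) < e" using d by blast
qed

text \<open>Near each point both \<open>u n\<close> and \<open>v\<close> differ from the value of
  \<open>v\<close> there by less than half of \<open>\<eta>\<close>; finitely many such
  neighbourhoods cover \<open>K\<close>.\<close>

lemma cconv_uniform_on_compact:
  assumes uv: "cconv u v" and K: "compact K" and "0 < \<eta>"
  shows "\<exists>n0. \<forall>n\<ge>n0. \<forall>x\<in>K. \<bar>u n x - v x\<bar> < \<eta>"
proof -
  have "\<exists>\<delta> n0. \<delta> > 0 \<and> (\<forall>n\<ge>n0. \<forall>y. dist y x < \<delta> \<longrightarrow> \<bar>u n y - v y\<bar> < \<eta>)" for x
  proof -
    obtain \<delta> n0 where d: "\<delta> > 0" "\<forall>n\<ge>n0. \<forall>y. dist y x < \<delta> \<longrightarrow> \<bar>u n y - v x\<bar> < \<eta> / 2"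
      using uv \<open>0 < \<eta>\<close> unfolding cconv_def by (meson half_gt_zero)
    obtain \<delta>' where d': "\<delta>' > 0" "\<forall>y. dist y x < \<delta>' \<longrightarrow> dist (v y) (v x) < \<eta> / 2"
      using cconv_continuous[OF uv] \<open>0 < \<eta>\<close> unfolding continuous_on_iff
      by (metis UNIV_I half_gt_zero)
    have "\<bar>u n y - v y\<bar> < \<eta>" if "n \<ge> n0" "dist y x < min \<delta> \<delta>'" for n y
    proof -
      have "\<bar>u n y - v x\<bar> < \<eta> / 2" "\<bar>v y - v x\<bar> < \<eta> / 2"
        using d d' that by (auto simp: dist_real_def)
      then show ?thesis by linarith
    qed
    then show ?thesis using d d' by (intro exI[of _ "min \<delta> \<delta>'"]) auto
  qed
  then obtain \<delta> n0 where *: "\<And>x. \<delta> x > 0"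
      "\<And>x. \<forall>n\<ge>n0 x. \<forall>y. dist y x < \<delta> x \<longrightarrow> \<bar>u n y - v y\<bar> < \<eta>"
    by metis
  have "K \<subseteq> (\<Union>x\<in>K. ball x (\<delta> x))" using *(1) by force
  from compactE_image[OF K open_ball this]
  obtain X where X: "finite X" "X \<subseteq> K" "K \<subseteq> (\<Union>x\<in>X. ball x (\<delta> x))" by metis
  have "\<bar>u n y - v y\<bar> < \<eta>" if ny: "n \<ge> Max (insert 0 (n0 ` X))" "y \<in> K" for n y
  proof -
    obtain x where "x \<in> X" "y \<in> ball x (\<delta> x)" using X ny by blast
    then have "x \<in> X" "dist y x < \<delta> x" by (auto simp: dist_commute)
    moreover from this have "n0 x \<le> n" using ny X(1)
      by (meson Max_ge finite_imageI finite_insert imageI insertI2 order_trans)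
    ultimately show ?thesis using * by blast
  qed
  then show ?thesis by blast
qed

text \<open>Integrand and measure vary together. On a large ball the integrands converge uniformly;
  outside it their difference is at most \<open>2 * C\<close> times the tail weight, whose integral
  is small for all large \<open>n\<close>.\<close>

lemma pweak_integral_cconv:
  fixes M :: "'a::euclidean_space measure"
  assumes p: "p = 0 \<or> p \<ge> 1" and Ms: "\<And>n. Ms n \<in> Pp p" and M: "M \<in> Pp p"
    and w: "pweak p Ms M" and uv: "cconv u v"
    and meas: "\<And>n. u n \<in> borel_measurable borel"
    and bd: "\<And>n x. \<bar>u n x\<bar> \<le> C * (1 + pw x p)"
  shows "(\<lambda>n. integ (Ms n) (u n)) \<longlonglongrightarrow> integ M v"
proof -
  have vbd: "\<bar>v x\<bar> \<le> C * (1 + pw x p)" for x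
    by (rule LIMSEQ_le_const2[OF tendsto_rabs[OF cconv_pointwise[OF uv]]]) (use bd in auto)
  have C0: "0 \<le> C"
    using order_trans[OF abs_ge_zero bd[of 0 0]] one_plus_pw_pos[of "0::'a" p]
    by (simp add: zero_le_mult_iff)
  have vg: "pgrowth p v" unfolding pgrowth_def using vbd cconv_continuous[OF uv] by blast
  have "(\<lambda>n. integ (Ms n) (u n) - integ (Ms n) v) \<longlonglongrightarrow> 0"
  proof (rule LIMSEQ_I)
    fix \<eta> :: real assume eta: "0 < \<eta>"
    \<comment> \<open>The tail term \<open>2 * C * (\<eta> / (4 * C + 4))\<close> stays below half
      of \<open>\<eta>\<close>; the summand 4 keeps the quotient meaningful for
      \<open>C = 0\<close>.\<close>
    have "0 < \<eta> / (4 * C + 4)" using eta C0 by simp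
    then obtain R where R: "1 \<le> R" "integ M (tail_weight p R) < \<eta> / (4 * C + 4)"
      using tail_weight_small[OF p M] by blast
    have "(\<lambda>n. integ (Ms n) (tail_weight p R)) \<longlonglongrightarrow> integ M (tail_weight p R)"
      using w pgrowth_tail_weight[OF p] unfolding pweak_def by blast
    then have "\<forall>\<^sub>F n in sequentially. integ (Ms n) (tail_weight p R) < \<eta> / (4 * C + 4)"
      using R(2) by (rule order_tendstoD)
    then obtain n1 where n1: "\<forall>n\<ge>n1. integ (Ms n) (tail_weight p R) < \<eta> / (4 * C + 4)"
      unfolding eventually_sequentially by auto
    \<comment> \<open>The tail weight has its full size \<open>1 + pw x p\<close> from radius
      \<open>R + 1\<close> on, so this ball and the tail together cover every point.\<close>
    obtain n2 where n2: "\<forall>n\<ge>n2. \<forall>x\<in>cball 0 (R + 1). \<bar>u n x - v x\<bar> < \<eta> / 4"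
      using cconv_uniform_on_compact[OF uv compact_cball, of "\<eta> / 4" 0 "R + 1"] eta
      by (metis zero_less_divide_iff zero_less_numeral)
    have "norm (integ (Ms n) (u n) - integ (Ms n) v - 0) < \<eta>" if n: "n \<ge> max n1 n2" for n
    proof -
      interpret prob_space "Ms n" using Ms PpD by blast
      have iu: "integrable (Ms n) (u n)" using Pp_integrable[OF Ms meas bd] .
      have iv: "integrable (Ms n) v" using pgrowth_integrable[OF Ms vg] .
      have it: "integrable (Ms n) (tail_weight p R)" by (rule pgrowth_integrable[OF Ms pgrowth_tail_weight[OF p]])
      have pt: "\<bar>u n x - v x\<bar> \<le> \<eta> / 4 + 2 * C * tail_weight p R x" for x
      proof (cases "norm x \<le> R + 1")
        case True
        then have "\<bar>u n x - v x\<bar> < \<eta> / 4" using n2 n by auto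
        moreover have "0 \<le> 2 * C * tail_weight p R x" using C0 tail_weight_nonneg[of p R x] by simp
        ultimately show ?thesis by linarith
      next
        case False
        have "\<bar>u n x - v x\<bar> \<le> 2 * C * (1 + pw x p)" using bd[of n x] vbd[of x] by linarith
        also have "\<dots> \<le> 2 * C * tail_weight p R x"
          using False C0 by (intro mult_left_mono tail_weight_ge) auto
        finally show ?thesis using eta by simp
      qed
      have "\<bar>integ (Ms n) (u n) - integ (Ms n) v\<bar> = \<bar>integ (Ms n) (\<lambda>x. u n x - v x)\<bar>"
        using iu iv by simp
      also have "\<dots> \<le> integ (Ms n) (\<lambda>x. \<bar>u n x - v x\<bar>)" by simp
      also have "\<dots> \<le> integ (Ms n) (\<lambda>x. \<eta> / 4 + 2 * C * tail_weight p R x)"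
        by (intro integral_mono) (use iu iv it pt in auto)
      also have "\<dots> = \<eta> / 4 + 2 * C * integ (Ms n) (tail_weight p R)"
        using it by (simp add: prob_space)
      also have "\<dots> \<le> \<eta> / 4 + 2 * C * (\<eta> / (4 * C + 4))"
        using n1 n C0 by (intro add_left_mono mult_left_mono) (auto intro: less_imp_le)
      also have "\<dots> < \<eta>" using eta C0 by (simp add: field_simps add_pos_nonneg)
      finally show ?thesis by simp
    qed
    then show "\<exists>no. \<forall>n\<ge>no. norm (integ (Ms n) (u n) - integ (Ms n) v - 0) < \<eta>" by blast
  qed
  moreover have "(\<lambda>n. integ (Ms n) v) \<longlonglongrightarrow> integ M v"
    using w vg unfolding pweak_def by blast
  ultimately have "(\<lambda>n. (integ (Ms n) (u n) - integ (Ms n) v) + integ (Ms n) v) \<longlonglongrightarrow> 0 + integ M v"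
    by (rule tendsto_add)
  then show ?thesis by simp
qed

section \<open>Mixtures of probability measures\<close>

lemma emeasure_mix:
  assumes N: "N \<in> Prob" and M: "M \<in> Prob" and A: "A \<in> sets borel"
  shows "emeasure (mix t N M) A = ennreal t * emeasure N A + ennreal (1 - t) * emeasure M A"
proof -
  have s: "sets N = sets borel" "sets M = sets borel" using N M by (auto simp: Prob_def)
  show ?thesis unfolding mix_def
  proof (rule emeasure_measure_of_sigma)
    show "sigma_algebra UNIV (sets borel)" by (metis sets.sigma_algebra_axioms space_borel)
    show "positive (sets borel) (\<lambda>A. ennreal t * emeasure N A + ennreal (1 - t) * emeasure M A)"
      by (auto simp: positive_def)
    show "countably_additive (sets borel) (\<lambda>A. ennreal t * emeasure N A + ennreal (1 - t) * emeasure M A)"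
      unfolding countably_additive_def
    proof (intro allI impI)
      fix A :: "nat \<Rightarrow> 'a set"
      assume A: "range A \<subseteq> sets borel" "disjoint_family A" "\<Union> (range A) \<in> sets borel"
      have "(\<Sum>i. emeasure N (A i)) = emeasure N (\<Union> (range A))"
           "(\<Sum>i. emeasure M (A i)) = emeasure M (\<Union> (range A))"
        using A s by (auto intro!: suminf_emeasure)
      then show "(\<Sum>i. ennreal t * emeasure N (A i) + ennreal (1 - t) * emeasure M (A i)) =
           ennreal t * emeasure N (\<Union> (range A)) + ennreal (1 - t) * emeasure M (\<Union> (range A))"
        by (simp add: suminf_add[symmetric])
    qed
  qed (use A in auto)
qed

lemma sets_mix: "sets (mix t N M) = sets borel"
  unfolding mix_def by (metis sets.sets_measure_of_eq space_borel)

lemma nn_integral_mix: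
  assumes N: "N \<in> Prob" and M: "M \<in> Prob" and "u \<in> borel_measurable borel"
  shows "(\<integral>\<^sup>+x. u x \<partial>mix t N M) = ennreal t * (\<integral>\<^sup>+x. u x \<partial>N) + ennreal (1 - t) * (\<integral>\<^sup>+x. u x \<partial>M)"
proof -
  have s: "sets N = sets borel" "sets M = sets borel" using N M by (auto simp: Prob_def)
  note [measurable_cong] = s sets_mix
  have sp: "space (mix t N M) = UNIV" "space N = UNIV" "space M = UNIV"
    using s sets_mix[of t N M] sets_eq_imp_space_eq space_borel by metis+
  show ?thesis using assms(3)
  proof (induction rule: borel_measurable_induct)
    case (cong f g)
    have "integral\<^sup>N L f = integral\<^sup>N L g" if "space L = UNIV" for L
      using cong(3) that by (intro nn_integral_cong) auto
    then show ?case using cong(4) sp by metis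
  next
    case (set A)
    then show ?case by (simp add: s sets_mix emeasure_mix[OF N M])
  next
    case (mult u c)
    then show ?case
      by (simp add: nn_integral_cmult) (simp add: algebra_simps)
  next
    case (add u v)
    then show ?case
      by (simp add: nn_integral_add) (simp add: algebra_simps)
  next
    case (seq U)
    have "(\<integral>\<^sup>+x. Sup (range (\<lambda>i. U i x)) \<partial>L) = (SUP i. \<integral>\<^sup>+x. U i x \<partial>L)"
      if "sets L = sets borel" for L
      using seq that by (intro nn_integral_monotone_convergence_SUP) (auto cong: measurable_cong_sets)
    note * = this[OF sets_mix[of t N M]] this[OF s(1)] this[OF s(2)]
    have inc: "incseq (\<lambda>i. \<integral>\<^sup>+x. U i x \<partial>L)" for L
      using seq by (auto simp: incseq_def le_fun_def intro!: nn_integral_mono)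
    have mi: "incseq (\<lambda>i. c * (\<integral>\<^sup>+x. U i x \<partial>L))" for L and c :: ennreal
      using inc[of L] by (auto simp: incseq_def intro: mult_left_mono)
    have "Sup (range U) = (\<lambda>x. Sup (range (\<lambda>i. U i x)))" by (auto simp: image_comp)
    then show ?case
      by (simp add: * seq.IH SUP_mult_left_ennreal ennreal_SUP_add[OF mi mi] )
  qed
qed

lemma mix_Pp:
  assumes t: "0 \<le> t" "t \<le> 1" and N: "N \<in> Pp p" and M: "M \<in> Pp p" and p: "p = 0 \<or> p \<ge> 1"
  shows "mix t N M \<in> Pp p"
proof -
  have P: "N \<in> Prob" "M \<in> Prob" using N M by (auto simp: Pp_def)
  interpret N: prob_space N using N PpD by blast
  interpret M: prob_space M using M PpD by blast
  have sp: "space (mix t N M) = UNIV" using sets_eq_imp_space_eq[OF sets_mix] by auto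
  have "emeasure (mix t N M) (space (mix t N M)) = 1"
    using emeasure_mix[OF P, of UNIV t] N.emeasure_space_1 M.emeasure_space_1 PpD(3)[OF N] PpD(3)[OF M] t
    by (simp add: sp ennreal_plus[symmetric] del: ennreal_plus)
  then have pr: "prob_space (mix t N M)" by (rule prob_spaceI)
  have meas: "(\<lambda>x. pw x p) \<in> borel_measurable borel"
    by (intro borel_measurable_continuous_onI continuous_on_pw[OF p])
  have "(\<integral>\<^sup>+x. ennreal (pw x p) \<partial>mix t N M) < \<infinity>"
    using PpD(4)[OF N] PpD(4)[OF M] meas
    by (subst nn_integral_mix[OF P])
       (auto simp: nn_integral_eq_integral ennreal_mult_less_top)
  then have "integrable (mix t N M) (\<lambda>x. pw x p)"
    using meas by (intro integrableI_nonneg) (auto simp: sets_mix cong: measurable_cong_sets)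
  then show ?thesis using pr by (simp add: Pp_def Prob_def sets_mix)
qed

lemma integral_mix:
  assumes t: "0 \<le> t" "t \<le> 1" and N: "N \<in> Pp p" and M: "M \<in> Pp p" and p: "p = 0 \<or> p \<ge> 1"
    and g: "pgrowth p \<phi>"
  shows "integ (mix t N M) \<phi> = t * integ N \<phi> + (1 - t) * integ M \<phi>"
proof -
  have P: "N \<in> Prob" "M \<in> Prob" using N M by (auto simp: Pp_def)
  have m: "\<phi> \<in> borel_measurable borel" by (rule pgrowth_measurable[OF g])
  have i: "integrable (mix t N M) \<phi>" "integrable N \<phi>" "integrable M \<phi>"
    using pgrowth_integrable[OF _ g] mix_Pp[OF assms(1-5)] N M by auto
  have fin: "(\<integral>\<^sup>+x. ennreal (\<phi> x) \<partial>L) < \<infinity>" "(\<integral>\<^sup>+x. ennreal (- \<phi> x) \<partial>L) < \<infinity>"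
    if "integrable L \<phi>" for L
    using that unfolding real_integrable_def by (auto simp: top.not_eq_extremum)
  have e: "enn2real (ennreal t * a + ennreal (1 - t) * b) = t * enn2real a + (1 - t) * enn2real b"
    if "a < \<infinity>" "b < \<infinity>" for a b
    using that t by (subst enn2real_plus) (auto simp: ennreal_mult_less_top enn2real_mult)
  show ?thesis
    unfolding real_lebesgue_integral_def[OF i(1)] real_lebesgue_integral_def[OF i(2)]
      real_lebesgue_integral_def[OF i(3)]
    using m e[OF fin(1)[OF i(2)] fin(1)[OF i(3)]] e[OF fin(2)[OF i(2)] fin(2)[OF i(3)]]
    by (simp add: nn_integral_mix[OF P]) (simp add: algebra_simps)
qed

text \<open>The integral against the mixture differs from that against \<open>M\<close> by
  \<open>t n\<close> times a null sequence. That the weights are arbitrary is the point: it makes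
  the integrand of the increment formula converge uniformly in its parameter.\<close>

lemma pweak_mix:
  assumes p: "p = 0 \<or> p \<ge> 1" and Ns: "\<And>n. Ns n \<in> Pp p" and M: "M \<in> Pp p"
    and w: "pweak p Ns M" and t: "\<And>n. 0 \<le> t n" "\<And>n. t n \<le> 1"
  shows "pweak p (\<lambda>n. mix (t n) (Ns n) M) M"
  unfolding pweak_def
proof (intro allI impI)
  fix \<phi> :: "'a \<Rightarrow> real" assume g: "pgrowth p \<phi>"
  have "(\<lambda>n. t n * (integ (Ns n) \<phi> - integ M \<phi>)) \<longlonglongrightarrow> 0"
  proof (rule Lim_null_comparison)
    show "\<forall>\<^sub>F n in sequentially. norm (t n * (integ (Ns n) \<phi> - integ M \<phi>)) \<le> \<bar>integ (Ns n) \<phi> - integ M \<phi>\<bar>"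
      using t by (intro always_eventually) (auto simp: abs_mult intro!: mult_left_le_one_le)
    show "(\<lambda>n. \<bar>integ (Ns n) \<phi> - integ M \<phi>\<bar>) \<longlonglongrightarrow> 0"
      using w g unfolding pweak_def by (intro tendsto_rabs_zero LIM_zero) auto
  qed
  then have "(\<lambda>n. t n * (integ (Ns n) \<phi> - integ M \<phi>) + integ M \<phi>) \<longlonglongrightarrow> 0 + integ M \<phi>"
    by (intro tendsto_intros)
  then show "(\<lambda>n. integ (mix (t n) (Ns n) M) \<phi>) \<longlonglongrightarrow> integ M \<phi>"
    by (simp add: integral_mix[OF t Ns M p g] algebra_simps)
qed

text \<open>Continuity of the segment between two measures in its parameter; it yields the
  continuity in \<open>t\<close> of the integrands of the increment formula.\<close>

lemma pweak_mix_weight: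
  assumes p: "p = 0 \<or> p \<ge> 1" and N: "N \<in> Pp p" and M: "M \<in> Pp p"
    and t: "\<And>n. 0 \<le> t n" "\<And>n. t n \<le> 1" "0 \<le> s" "s \<le> 1" "t \<longlonglongrightarrow> s"
  shows "pweak p (\<lambda>n. mix (t n) N M) (mix s N M)"
  unfolding pweak_def
proof (intro allI impI)
  fix \<phi> :: "'a \<Rightarrow> real" assume g: "pgrowth p \<phi>"
  show "(\<lambda>n. integ (mix (t n) N M) \<phi>) \<longlonglongrightarrow> integ (mix s N M) \<phi>"
    using t by (simp add: integral_mix[OF _ _ N M p g]) (intro tendsto_intros)
qed

section \<open>Quantization by a positive partition of unity\<close>

text \<open>The lower bound \<open>\<epsilon>\<close> keeps the weights away from the boundary of the simplex; the last condition
  says that points further than \<open>1 / R\<close> from \<open>x\<close> carry negligible mass, even after weighting by \<open>1 + R powr p\<close>.\<close>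

definition quantizer :: "real \<Rightarrow> real \<Rightarrow> nat \<Rightarrow> (nat \<Rightarrow> 'a::euclidean_space) \<Rightarrow> (nat \<Rightarrow> 'a \<Rightarrow> real) \<Rightarrow> real \<Rightarrow> bool" where
  "quantizer p R m xs \<psi> \<epsilon> \<longleftrightarrow> 1 \<le> R \<and> 0 < m \<and> 0 < \<epsilon> \<and>
     (\<forall>i<m. continuous_on UNIV (\<psi> i) \<and> (\<forall>x. \<epsilon> \<le> \<psi> i x) \<and> norm (xs i) \<le> R) \<and>
     (\<forall>x. (\<Sum>i<m. \<psi> i x) = 1) \<and>
     (\<forall>x. norm x \<le> R \<longrightarrow> (\<Sum>i | i < m \<and> 1 / R \<le> dist (xs i) x. \<psi> i x) * (1 + R powr p) \<le> 1 / R)"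

lemma quantizerD:
  assumes "quantizer p R m xs \<psi> \<epsilon>"
  shows "1 \<le> R" "0 < m" "0 < \<epsilon>" "i < m \<Longrightarrow> continuous_on UNIV (\<psi> i)" "i < m \<Longrightarrow> \<epsilon> \<le> \<psi> i x"
    "i < m \<Longrightarrow> 0 < \<psi> i x" "i < m \<Longrightarrow> norm (xs i) \<le> R" "(\<Sum>i<m. \<psi> i x) = 1"
    "norm x \<le> R \<Longrightarrow> (\<Sum>i | i < m \<and> 1 / R \<le> dist (xs i) x. \<psi> i x) * (1 + R powr p) \<le> 1 / R"
    "i < m \<Longrightarrow> \<psi> i x \<le> 1"
proof -
  show *: "1 \<le> R" "0 < m" "0 < \<epsilon>" "i < m \<Longrightarrow> continuous_on UNIV (\<psi> i)" "\<And>i. i < m \<Longrightarrow> \<epsilon> \<le> \<psi> i x"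
    "i < m \<Longrightarrow> norm (xs i) \<le> R" "(\<Sum>i<m. \<psi> i x) = 1"
    "norm x \<le> R \<Longrightarrow> (\<Sum>i | i < m \<and> 1 / R \<le> dist (xs i) x. \<psi> i x) * (1 + R powr p) \<le> 1 / R"
    using assms by (auto simp: quantizer_def)
  show pos: "0 < \<psi> i x" if "i < m" for i using *(3) *(5)[OF that] by linarith
  show "\<psi> i x \<le> 1" if "i < m"
    using member_le_sum[of i "{..<m}" "\<lambda>i. \<psi> i x"] pos that *(7) by (simp add: less_imp_le)
qed

text \<open>Tent functions of radius \<open>1 / R\<close> around a finite
  \<open>1 / (2 * R)\<close>-net of the ball are all raised by a small floor \<open>e\<close> and
  normalized. The floor bounds the functions from below; its smallness keeps the weight of distant
  points negligible.\<close>

lemma quantizer_exists: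
  assumes R: "1 \<le> R"
  shows "\<exists>m xs \<psi> \<epsilon>. quantizer p R m (xs :: nat \<Rightarrow> 'a::euclidean_space) \<psi> \<epsilon>"
proof -
  have "0 < 1 / (2 * R)" using R by simp
  then obtain X where X: "finite X" "X \<subseteq> cball (0::'a) R" "cball 0 R \<subseteq> (\<Union>x\<in>X. ball x (1 / (2 * R)))"
    using seq_compact_imp_totally_bounded[OF compact_imp_seq_compact[OF compact_cball, of "0::'a" R]] by meson
  obtain m :: nat and xs where mxs: "X = xs ` {i. i < m}"
    using X(1) unfolding finite_conv_nat_seg_image by blast
  have "X \<noteq> {}" using X(3) R by fastforce
  then have m: "0 < m" using mxs by auto
  \<comment> \<open>At distance at least \<open>1 / R\<close> only the floor is left of a numerator,
    while inside the ball a nearby net point keeps the denominator above \<open>1 / (2 * R)\<close>.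
    The distant weight is thus at most \<open>m * e * 2 * R\<close>, which this choice makes equal
    to \<open>1 / (R * (1 + R powr p))\<close>.\<close>
  define e where "e = 1 / (2 * R * R * (1 + R powr p) * m)"
  have e: "0 < e" using R m by (auto simp: e_def add_pos_nonneg)
  define b where "b i x = max 0 (1 / R - dist (xs i) x)" for i x
  define S where "S x = (\<Sum>j<m. b j x + e)" for x
  define \<psi> where "\<psi> i x = (b i x + e) / S x" for i x
  have b: "0 \<le> b i x" "b i x \<le> 1 / R" for i x using R by (auto simp: b_def)
  have Sge: "real m * e \<le> S x" for x
    using sum_mono[of "{..<m}" "\<lambda>_. e" "\<lambda>j. b j x + e"] b by (simp add: S_def)
  have Spos: "0 < S x" for x using Sge[of x] e m by (smt (verit) mult_pos_pos of_nat_0_less_iff)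
  have Sle: "S x \<le> real m * (1 / R + e)" for x
    using sum_mono[of "{..<m}" "\<lambda>j. b j x + e" "\<lambda>_. 1 / R + e"] b by (simp add: S_def)
  define \<epsilon> where "\<epsilon> = e / (real m * (1 / R + e))"
  have "0 < \<epsilon>" using e m R by (auto simp: \<epsilon>_def intro!: divide_pos_pos mult_pos_pos add_pos_pos)
  moreover have "continuous_on UNIV (\<psi> i)" for i
    unfolding \<psi>_def S_def b_def
    using Spos unfolding S_def b_def by (intro continuous_intros) (auto simp: less_imp_neq[symmetric])
  moreover have "\<epsilon> \<le> \<psi> i x" for i x
    unfolding \<epsilon>_def \<psi>_def using b[of i x] e Sle[of x] Spos[of x] by (intro frac_le) auto
  moreover have "norm (xs i) \<le> R" if "i < m" for i using X(2) mxs that by auto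
  moreover have "(\<Sum>i<m. \<psi> i x) = 1" for x
    unfolding \<psi>_def sum_divide_distrib[symmetric] S_def[symmetric] using Spos[of x] by simp
  moreover have "(\<Sum>i | i < m \<and> 1 / R \<le> dist (xs i) x. \<psi> i x) * (1 + R powr p) \<le> 1 / R"
    if x: "norm x \<le> R" for x
  proof -
    obtain j where j: "j < m" "dist (xs j) x < 1 / (2 * R)"
      using X(3) x mxs by (auto simp: subset_iff)
    have "1 / R = 2 * (1 / (2 * R))" by simp
    then have "1 / (2 * R) \<le> b j x + e" using j(2) e unfolding b_def by linarith
    also have "\<dots> \<le> S x" unfolding S_def using j b e
      by (intro member_le_sum[where f = "\<lambda>j. b j x + e"]) (auto simp: add_nonneg_nonneg)
    finally have S1: "1 / (2 * R) \<le> S x" .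
    have "(\<Sum>i | i < m \<and> 1 / R \<le> dist (xs i) x. \<psi> i x) = (\<Sum>i | i < m \<and> 1 / R \<le> dist (xs i) x. e / S x)"
      by (intro sum.cong) (auto simp: \<psi>_def b_def)
    also have "\<dots> \<le> (\<Sum>i<m. e / S x)"
      using e Spos[of x] by (intro sum_mono2) (auto simp: less_imp_le)
    also have "\<dots> = real m * (e / S x)" by simp
    also have "\<dots> \<le> real m * (e / (1 / (2 * R)))"
      using e S1 R Spos[of x] by (intro mult_left_mono divide_left_mono) auto
    also have "\<dots> = 1 / (R * (1 + R powr p))"
    proof -
      have "real m * (1 / (2 * R * R * Q * real m) / (1 / (2 * R))) = 1 / (R * Q)" if "0 < Q" for Q
        using m R that by (simp add: field_simps)
      from this[of "1 + R powr p"] show ?thesis unfolding e_def by (simp add: add_pos_nonneg)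
    qed
    finally have "(\<Sum>i | i < m \<and> 1 / R \<le> dist (xs i) x. \<psi> i x) * (1 + R powr p)
        \<le> 1 / (R * (1 + R powr p)) * (1 + R powr p)"
      by (rule mult_right_mono) (auto simp: add_nonneg_nonneg)
    also have "\<dots> = 1 / R"
    proof -
      have "1 / (R * Q) * Q = 1 / R" if "0 < Q" for Q using that by simp
      moreover have "0 < 1 + R powr p" by (simp add: add_pos_nonneg)
      ultimately show ?thesis by blast
    qed
    finally show ?thesis .
  qed
  ultimately have "quantizer p R m xs \<psi> \<epsilon>" using R m unfolding quantizer_def by blast
  then show ?thesis by blast
qed

text \<open>The operator dual to quantization: integrating \<open>qavg m xs \<psi> u\<close> against
  a measure is integrating \<open>u\<close> against its quantization, see
  \<open>integral_quant\<close>. Applied to \<open>D\<close>, it is also the derivative that the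
  cylinder functions have to approximate.\<close>

definition qavg :: "nat \<Rightarrow> (nat \<Rightarrow> 'a) \<Rightarrow> (nat \<Rightarrow> 'a \<Rightarrow> real) \<Rightarrow> ('a \<Rightarrow> real) \<Rightarrow> 'a::euclidean_space \<Rightarrow> real" where
  "qavg m xs \<psi> u x = (\<Sum>i<m. \<psi> i x * u (xs i))"

lemma qavg_mono:
  assumes q: "quantizer p R m xs \<psi> \<epsilon>" and "\<And>i. i < m \<Longrightarrow> u (xs i) \<le> v (xs i)"
  shows "qavg m xs \<psi> u x \<le> qavg m xs \<psi> v x"
  unfolding qavg_def using quantizerD(6)[OF q] assms(2)
  by (intro sum_mono mult_left_mono) (auto intro: less_imp_le)

lemma abs_qavg_le:
  assumes q: "quantizer p R m xs \<psi> \<epsilon>"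
  shows "\<bar>qavg m xs \<psi> u x\<bar> \<le> qavg m xs \<psi> (\<lambda>z. \<bar>u z\<bar>) x"
  unfolding qavg_def
  by (rule order_trans[OF sum_abs])
     (auto intro!: sum_mono simp: abs_mult abs_of_pos[OF quantizerD(6)[OF q]])

lemma qavg_const:
  assumes q: "quantizer p R m xs \<psi> \<epsilon>" shows "qavg m xs \<psi> (\<lambda>z. c) x = c"
  unfolding qavg_def sum_distrib_right[symmetric] using quantizerD(8)[OF q] by simp

text \<open>Atoms closer than \<open>1 / R\<close> contribute at most \<open>\<eta>\<close>. At the
  others \<open>u\<close> may differ from \<open>c\<close> by
  \<open>(C + \<bar>c\<bar>) * (1 + R powr p)\<close>, as all atoms have norm at most
  \<open>R\<close>; the last clause of \<open>quantizer\<close> cancels exactly this growth.\<close>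

lemma qavg_near:
  assumes p: "p = 0 \<or> p \<ge> 1" and q: "quantizer p R m xs \<psi> \<epsilon>"
    and bd: "\<And>y. \<bar>u y\<bar> \<le> C * (1 + pw y p)"
    and x: "norm x \<le> R" and near: "\<And>y. dist y x < 1 / R \<Longrightarrow> \<bar>u y - c\<bar> \<le> \<eta>" and eta: "0 \<le> \<eta>"
  shows "\<bar>qavg m xs \<psi> u x - c\<bar> \<le> \<eta> + (C + \<bar>c\<bar>) / R"
proof -
  let ?F = "{i. i < m \<and> 1 / R \<le> dist (xs i) x}"
  let ?K = "(C + \<bar>c\<bar>) * (1 + R powr p)"
  have C0: "0 \<le> C"
    using order_trans[OF abs_ge_zero bd[of 0]] one_plus_pw_pos[of "0::'a" p]
    by (simp add: zero_le_mult_iff)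
  have pwR: "pw (xs i) p \<le> R powr p" if "i < m" for i
    using p quantizerD(1,7)[OF q] that by (auto simp: pw_def intro!: powr_mono2)
  have pt: "\<psi> i x * \<bar>u (xs i) - c\<bar> \<le> \<psi> i x * \<eta> + (if i \<in> ?F then \<psi> i x * ?K else 0)" if i: "i < m" for i
  proof (cases "i \<in> ?F")
    case True
    have "\<bar>u (xs i) - c\<bar> \<le> C * (1 + R powr p) + \<bar>c\<bar> * 1"
      using bd[of "xs i"] mult_left_mono[OF pwR[OF i] C0] by (simp add: algebra_simps)
    also have "\<dots> \<le> C * (1 + R powr p) + \<bar>c\<bar> * (1 + R powr p)"
      by (intro add_left_mono mult_left_mono) auto
    also have "\<dots> \<le> \<eta> + ?K" using eta by (simp add: algebra_simps)
    finally have "\<bar>u (xs i) - c\<bar> \<le> \<eta> + ?K" .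
    from mult_left_mono[OF this less_imp_le[OF quantizerD(6)[OF q i, of x]]] True
    show ?thesis by (simp add: algebra_simps)
  next
    case False
    then have "\<bar>u (xs i) - c\<bar> \<le> \<eta>" using near i by auto
    from mult_left_mono[OF this less_imp_le[OF quantizerD(6)[OF q i, of x]]] False
    show ?thesis by auto
  qed
  have "qavg m xs \<psi> u x - c = (\<Sum>i<m. \<psi> i x * (u (xs i) - c))"
    using quantizerD(8)[OF q, of x]
    by (simp add: qavg_def right_diff_distrib sum_subtractf sum_distrib_right[symmetric])
  also have "\<bar>\<dots>\<bar> \<le> (\<Sum>i<m. \<psi> i x * \<bar>u (xs i) - c\<bar>)"
    using quantizerD(6)[OF q] by (intro order_trans[OF sum_abs] sum_mono) (auto simp: abs_mult less_imp_le)
  also have "\<dots> \<le> (\<Sum>i<m. \<psi> i x * \<eta> + (if i \<in> ?F then \<psi> i x * ?K else 0))"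
    by (intro sum_mono pt) auto
  also have "\<dots> = (\<Sum>i<m. \<psi> i x) * \<eta> + (\<Sum>i\<in>?F. \<psi> i x) * ?K"
    by (simp add: sum.distrib sum_distrib_right sum.inter_filter[symmetric])
  also have "\<dots> = \<eta> + (C + \<bar>c\<bar>) * ((\<Sum>i\<in>?F. \<psi> i x) * (1 + R powr p))"
    using quantizerD(8)[OF q, of x] by (simp add: algebra_simps)
  also have "\<dots> \<le> \<eta> + (C + \<bar>c\<bar>) * (1 / R)"
    using C0 by (intro add_left_mono mult_left_mono quantizerD(9)[OF q x]) auto
  finally show ?thesis by simp
qed

text \<open>The constant depends on \<open>C\<close> and \<open>p\<close> but not on the quantizer,
  which is what makes later bounds uniform in the level. Inside the ball, relevant atoms lie within
  distance 1 of \<open>x\<close>; outside it, every atom has smaller norm than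
  \<open>x\<close>.\<close>

lemma qavg_growth:
  assumes p: "p = 0 \<or> p \<ge> 1" and q: "quantizer p R m xs \<psi> \<epsilon>"
    and bd: "\<And>y. \<bar>u y\<bar> \<le> C * (1 + pw y p)"
  shows "\<bar>qavg m xs \<psi> u x\<bar> \<le> C * (2 + 2 powr p) * (1 + pw x p)"
proof -
  have C0: "0 \<le> C"
    using order_trans[OF abs_ge_zero bd[of 0]] one_plus_pw_pos[of "0::'a" p]
    by (simp add: zero_le_mult_iff)
  have R: "1 \<le> R" using quantizerD[OF q] by simp
  show ?thesis
  proof (cases "norm x \<le> R")
    case True
    have "\<bar>u y - 0\<bar> \<le> C * (1 + 2 powr p) * (1 + pw x p)" if "dist y x < 1 / R" for y
    proof -
      have "1 / R \<le> 1" using R by simp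
      then have n1: "norm (y - x) \<le> 1" using that by (simp add: dist_norm)
      have "pw (y - x) p \<le> 1"
        using p powr_le1[of p "norm (y - x)"] n1 by (auto simp: pw_def)
      then have "2 powr p * (pw (y - x) p + pw x p) \<le> 2 powr p * (1 + pw x p)"
        by (intro mult_left_mono) auto
      then have "pw y p \<le> 2 powr p * (1 + pw x p)"
        using pw_add_le[OF p, of "y - x" x] by (metis diff_add_cancel order_trans)
      then have "1 + pw y p \<le> (1 + pw x p) + 2 powr p * (1 + pw x p)"
        by (intro add_mono) auto
      then have "1 + pw y p \<le> (1 + 2 powr p) * (1 + pw x p)"
        unfolding distrib_right mult_1 .
      then have "C * (1 + pw y p) \<le> C * ((1 + 2 powr p) * (1 + pw x p))"
        using C0 by (rule mult_left_mono)
      then show ?thesis using bd[of y] by (simp add: mult.assoc)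
    qed
    from qavg_near[OF p q bd True this]
    have "\<bar>qavg m xs \<psi> u x - 0\<bar> \<le> C * (1 + 2 powr p) * (1 + pw x p) + (C + \<bar>0\<bar>) / R"
      using C0 by (simp add: add_nonneg_nonneg)
    moreover have "C / R \<le> C * (1 + pw x p)"
    proof -
      have "C / R \<le> C" using C0 R mult_left_mono[OF R C0] by (simp add: divide_le_eq)
      also have "\<dots> \<le> C * (1 + pw x p)" using C0 by (simp add: algebra_simps)
      finally show ?thesis .
    qed
    ultimately show ?thesis by (simp add: algebra_simps)
  next
    case False
    have "\<bar>u (xs i)\<bar> \<le> C * (1 + pw x p)" if "i < m" for i
    proof -
      have "pw (xs i) p \<le> pw x p" using False quantizerD(7)[OF q that] by (intro pw_mono[OF p]) auto
      then have "C * (1 + pw (xs i) p) \<le> C * (1 + pw x p)" using C0 by (intro mult_left_mono) auto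
      then show ?thesis using bd[of "xs i"] by linarith
    qed
    then have "\<bar>qavg m xs \<psi> u x\<bar> \<le> C * (1 + pw x p)"
      using abs_qavg_le[OF q, of u x] qavg_mono[OF q, of "\<lambda>z. \<bar>u z\<bar>" "\<lambda>z. C * (1 + pw x p)" x] qavg_const[OF q]
      by fastforce
    also have "\<dots> = C * 1 * (1 + pw x p)" by simp
    also have "\<dots> \<le> C * (2 + 2 powr p) * (1 + pw x p)"
      using C0 by (intro mult_right_mono mult_left_mono) (auto simp: add_increasing2)
    finally show ?thesis .
  qed
qed

lemma qavg_cconv:
  assumes p: "p = 0 \<or> p \<ge> 1" and q: "\<And>n. quantizer p (R n) (m n) (xs n) (\<psi> n) (\<epsilon> n)"
    and R: "filterlim R at_top sequentially"
    and uv: "cconv u v" and bd: "\<And>n y. \<bar>u n y\<bar> \<le> C * (1 + pw y p)"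
  shows "cconv (\<lambda>n. qavg (m n) (xs n) (\<psi> n) (u n)) v"
  unfolding cconv_def
proof (intro allI impI)
  fix x :: 'a and \<eta> :: real assume eta: "0 < \<eta>"
  have C0: "0 \<le> C"
    using order_trans[OF abs_ge_zero bd[of 0 0]] one_plus_pw_pos[of "0::'a" p]
    by (simp add: zero_le_mult_iff)
  obtain \<delta> n0 where d: "\<delta> > 0" "\<forall>n\<ge>n0. \<forall>y. dist y x < \<delta> \<longrightarrow> \<bar>u n y - v x\<bar> < \<eta> / 2"
    using uv eta unfolding cconv_def by (meson half_gt_zero)
  \<comment> \<open>The three entries serve in turn to put \<open>y\<close> into the ball of radius
    \<open>R n\<close>, to make \<open>1 / R n\<close> smaller than \<open>\<delta> / 2\<close>, and
    to make the error \<open>(C + \<bar>v x\<bar>) / R n\<close> smaller than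
    \<open>\<eta> / 2\<close>.\<close>
  let ?B = "max (norm x + \<delta>) (max (2 / \<delta>) (2 * (C + \<bar>v x\<bar>) / \<eta>)) + 1"
  have "\<forall>\<^sub>F n in sequentially. R n \<ge> ?B" using R unfolding filterlim_at_top by blast
  then obtain n1 where n1: "\<And>n. n \<ge> n1 \<Longrightarrow> R n \<ge> ?B" unfolding eventually_sequentially by blast
  have "\<bar>qavg (m n) (xs n) (\<psi> n) (u n) y - v x\<bar> < \<eta>" if n: "n \<ge> max n0 n1" and y: "dist y x < \<delta> / 2" for n y
  proof -
    have Rn: "R n > norm x + \<delta>" "R n > 2 / \<delta>" "R n > 2 * (C + \<bar>v x\<bar>) / \<eta>" "R n \<ge> 1"
      using n1[of n] n quantizerD(1)[OF q] by auto
    have "norm y \<le> norm x + dist y x" by (metis dist_norm norm_triangle_sub)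
    then have "norm y \<le> R n" using y Rn d(1) by linarith
    moreover have "\<bar>u n z - v x\<bar> \<le> \<eta> / 2" if "dist z y < 1 / R n" for z
    proof -
      have "1 / R n < \<delta> / 2" using Rn d(1) by (simp add: field_simps)
      then have "dist z x < \<delta>" using that y dist_triangle[of z x y] by linarith
      then show ?thesis using d(2) n by (simp add: less_imp_le)
    qed
    ultimately have "\<bar>qavg (m n) (xs n) (\<psi> n) (u n) y - v x\<bar> \<le> \<eta> / 2 + (C + \<bar>v x\<bar>) / R n"
      using eta by (intro qavg_near[OF p q bd]) auto
    also have "(C + \<bar>v x\<bar>) / R n < \<eta> / 2" using Rn eta by (simp add: field_simps)
    finally show ?thesis by simp
  qed
  then show "\<exists>\<delta>>0. \<exists>n0. \<forall>n\<ge>n0. \<forall>y. dist y x < \<delta> \<longrightarrow> \<bar>qavg (m n) (xs n) (\<psi> n) (u n) y - v x\<bar> < \<eta>"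
    using d(1) half_gt_zero by blast
qed

lemma continuous_on_qavg:
  assumes q: "quantizer p R m xs \<psi> \<epsilon>" shows "continuous_on UNIV (qavg m xs \<psi> u)"
  unfolding qavg_def using quantizerD(4)[OF q] by (intro continuous_intros) auto

lemma qavg_pgrowth:
  assumes q: "quantizer p R m xs \<psi> \<epsilon>" shows "pgrowth p (qavg m xs \<psi> u)"
proof (rule pgrowth_bounded[OF continuous_on_qavg[OF q]])
  show "\<bar>qavg m xs \<psi> u x\<bar> \<le> (\<Sum>i<m. \<bar>u (xs i)\<bar>)" for x
    unfolding qavg_def
    by (rule order_trans[OF sum_abs])
       (auto intro!: sum_mono mult_left_le_one_le simp: abs_mult abs_of_pos[OF quantizerD(6)[OF q]]
         quantizerD(10)[OF q] less_imp_le[OF quantizerD(6)[OF q]])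
qed

lemma quantizer_pgrowth:
  assumes q: "quantizer p R m xs \<psi> \<epsilon>" "i < m" shows "pgrowth p' (\<psi> i)"
  by (rule pgrowth_bounded[OF quantizerD(4)[OF q], of 1])
     (simp add: abs_of_pos[OF quantizerD(6)[OF q]] quantizerD(10)[OF q])

text \<open>Obtained by pushing forward weights on the indices, so that atoms which coincide simply
  add their weights and injectivity of \<open>xs\<close> is never an issue.\<close>

definition discrete_measure :: "nat \<Rightarrow> (nat \<Rightarrow> 'a::euclidean_space) \<Rightarrow> (nat \<Rightarrow> real) \<Rightarrow> 'a measure" where
  "discrete_measure m xs w = distr (point_measure {..<m} (\<lambda>i. ennreal (w i))) borel xs"

lemma integral_discrete_measure:
  assumes "\<And>i. i < m \<Longrightarrow> 0 \<le> w i" "\<phi> \<in> borel_measurable borel"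
  shows "integ (discrete_measure m xs w) \<phi> = (\<Sum>i<m. w i * \<phi> (xs i))"
proof -
  have "integ (discrete_measure m xs w) \<phi> = integral\<^sup>L (point_measure {..<m} (\<lambda>i. ennreal (w i))) (\<lambda>i. \<phi> (xs i))"
    unfolding discrete_measure_def using assms by (subst integral_distr) auto
  also have "\<dots> = (\<Sum>i<m. w i *\<^sub>R \<phi> (xs i))"
    using assms by (intro lebesgue_integral_point_measure_finite) auto
  finally show ?thesis by simp
qed

lemma discrete_measure_Pp:
  assumes "\<And>i. i < m \<Longrightarrow> 0 \<le> w i" "(\<Sum>i<m. w i) = 1" and p: "p = 0 \<or> p \<ge> 1"
  shows "discrete_measure m (xs :: nat \<Rightarrow> 'a::euclidean_space) w \<in> Pp p"
proof -
  have "prob_space (point_measure {..<m} (\<lambda>i. ennreal (w i)))"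
    using assms sum_ennreal[of "{..<m}" w]
    by (intro prob_spaceI) (simp add: space_point_measure emeasure_point_measure_finite)
  then have "prob_space (discrete_measure m xs w)"
    unfolding discrete_measure_def by (rule prob_space.prob_space_distr) simp
  moreover have "integrable (discrete_measure m xs w) (\<lambda>x. pw x p)"
    unfolding discrete_measure_def
  proof (subst integrable_distr_eq)
    show "(\<lambda>x::'a. pw x p) \<in> borel_measurable borel"
      by (intro borel_measurable_continuous_onI continuous_on_pw[OF p])
    show "integrable (point_measure {..<m} (\<lambda>i. ennreal (w i))) (\<lambda>x. pw (xs x) p)"
      by (rule integrable_point_measure_finite) auto
  qed simp
  ultimately show ?thesis by (simp add: Pp_def Prob_def discrete_measure_def)
qed

definition quant :: "nat \<Rightarrow> (nat \<Rightarrow> 'a::euclidean_space) \<Rightarrow> (nat \<Rightarrow> 'a \<Rightarrow> real) \<Rightarrow> 'a measure \<Rightarrow> 'a measure" where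
  "quant m xs \<psi> M = discrete_measure m xs (\<lambda>i. integ M (\<psi> i))"

lemma quantizer_weights:
  assumes q: "quantizer p R m xs \<psi> \<epsilon>" and M: "M \<in> Pp p'"
  shows "(\<Sum>i<m. integ M (\<psi> i)) = 1" "i < m \<Longrightarrow> \<epsilon> \<le> integ M (\<psi> i)" "i < m \<Longrightarrow> integ M (\<psi> i) \<le> 1"
    "i < m \<Longrightarrow> 0 < integ M (\<psi> i)"
proof -
  interpret prob_space M using M PpD by blast
  have i: "integrable M (\<psi> i)" if "i < m" for i
    using pgrowth_integrable[OF M quantizer_pgrowth[OF q that]] .
  have "(\<Sum>i<m. integ M (\<psi> i)) = integ M (\<lambda>x. \<Sum>i<m. \<psi> i x)"
    using i by (subst Bochner_Integration.integral_sum) auto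
  then show "(\<Sum>i<m. integ M (\<psi> i)) = 1" using quantizerD(8)[OF q] by (simp add: prob_space)
  show g: "\<epsilon> \<le> integ M (\<psi> i)" if "i < m"
    using quantizerD(5)[OF q that] i[OF that] by (intro integral_ge_const) auto
  show "integ M (\<psi> i) \<le> 1" if "i < m"
    using quantizerD(10)[OF q that] i[OF that] by (intro integral_le_const) auto
  show "0 < integ M (\<psi> i)" if "i < m" using g that quantizerD(3)[OF q] by simp
qed

lemma quant_Pp:
  assumes p: "p = 0 \<or> p \<ge> 1" and q: "quantizer p R m xs \<psi> \<epsilon>" and M: "M \<in> Pp p"
  shows "quant m xs \<psi> M \<in> Pp p"
  unfolding quant_def using quantizer_weights[OF q M] by (intro discrete_measure_Pp[OF _ _ p]) (auto intro: less_imp_le)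

lemma integral_quant:
  assumes q: "quantizer p R m xs \<psi> \<epsilon>" and M: "M \<in> Pp p" and "\<phi> \<in> borel_measurable borel"
  shows "integ (quant m xs \<psi> M) \<phi> = integ M (qavg m xs \<psi> \<phi>)"
proof -
  have "integ (quant m xs \<psi> M) \<phi> = (\<Sum>i<m. integ M (\<psi> i) * \<phi> (xs i))"
    unfolding quant_def using quantizer_weights(4)[OF q M] assms(3)
    by (intro integral_discrete_measure) (auto intro: less_imp_le)
  also have "\<dots> = integ M (qavg m xs \<psi> \<phi>)"
    unfolding qavg_def using pgrowth_integrable[OF M quantizer_pgrowth[OF q]]
    by (subst Bochner_Integration.integral_sum) auto
  finally show ?thesis .
qed

section \<open>Convergence in P_p is convergence of integrals of growth-p functions\<close>

abbreviation cost :: "real \<Rightarrow> ('a::euclidean_space \<times> 'a) measure \<Rightarrow> ennreal" where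
  "cost p \<pi> \<equiv> \<integral>\<^sup>+ z. ennreal (dist (fst z) (snd z) powr p) \<partial>\<pi>"

lemma dist_powr_le:
  fixes x y z :: "'a::euclidean_space"
  assumes "p \<ge> 1"
  shows "dist x y powr p \<le> 2 powr p * (pw (x - z) p + pw (y - z) p)"
proof -
  have "dist x y powr p = pw ((x - z) + (z - y)) p" using assms by (simp add: pw_def dist_norm)
  also have "\<dots> \<le> 2 powr p * (pw (x - z) p + pw (z - y) p)" using assms by (intro pw_add_le) auto
  also have "pw (z - y) p = pw (y - z) p" by (simp add: pw_def norm_minus_commute)
  finally show ?thesis .
qed

text \<open>By Tonelli, partial integrals equal to 1 are precisely what gives the right marginals.
  Used with the constant density for the product coupling and with the density constructed in
  \<open>Inf_cost_le\<close>.\<close>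

lemma density_coupling:
  fixes N M :: "'a::euclidean_space measure"
  assumes N: "N \<in> Pp p" and M: "M \<in> Pp p" and g: "g \<in> borel_measurable borel"
    and fst1: "\<And>x. (\<integral>\<^sup>+y. g (x, y) \<partial>M) = 1" and snd1: "\<And>y. (\<integral>\<^sup>+x. g (x, y) \<partial>N) = 1"
  shows "density (N \<Otimes>\<^sub>M M) g \<in> couplings N M"
    and "cost p (density (N \<Otimes>\<^sub>M M) g) = (\<integral>\<^sup>+x. \<integral>\<^sup>+y. g (x, y) * ennreal (dist x y powr p) \<partial>M \<partial>N)"
proof -
  interpret N: prob_space N using N PpD by blast
  interpret M: prob_space M using M PpD by blast
  interpret NM: pair_prob_space N M ..
  have s[measurable_cong]: "sets N = sets borel" "sets M = sets borel" using N M PpD by blast+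
  have sP: "sets (N \<Otimes>\<^sub>M M) = sets borel"
    using sets_pair_measure_cong[OF s] unfolding borel_prod .
  have sp: "space N = UNIV" "space M = UNIV" using N M PpD by blast+
  have g'[measurable]: "g \<in> borel_measurable (N \<Otimes>\<^sub>M M)"
    using g by (simp add: sP cong: measurable_cong_sets)
  let ?P = "density (N \<Otimes>\<^sub>M M) g"
  have spNM: "space (N \<Otimes>\<^sub>M M) = UNIV" by (simp add: space_pair_measure sp)
  then have spP: "space ?P = UNIV" by simp
  have f: "distr ?P borel fst = N"
  proof (rule measure_eqI)
    fix A assume "A \<in> sets (distr ?P borel fst)"
    then have A: "A \<in> sets borel" by simp
    then have [measurable]: "A \<in> sets N" using s by simp
    have A': "A \<times> UNIV \<in> sets (N \<Otimes>\<^sub>M M)"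
      using pair_measureI[of A N UNIV M] A s by simp
    have "emeasure (distr ?P borel fst) A = emeasure ?P (A \<times> UNIV)"
      using A by (subst emeasure_distr) (auto simp: spNM intro!: arg_cong[of _ _ "emeasure ?P"])
    also have "\<dots> = (\<integral>\<^sup>+z. g z * indicator (A \<times> UNIV) z \<partial>(N \<Otimes>\<^sub>M M))"
      by (rule emeasure_density[OF g' A'])
    also have "\<dots> = (\<integral>\<^sup>+x. \<integral>\<^sup>+y. g (x, y) * indicator (A \<times> UNIV) (x, y) \<partial>M \<partial>N)"
      using A' by (subst M.nn_integral_fst) auto
    also have "\<dots> = (\<integral>\<^sup>+x. indicator A x \<partial>N)"
    proof (intro nn_integral_cong)
      fix x
      have "(\<integral>\<^sup>+y. g (x, y) * indicator (A \<times> UNIV) (x, y) \<partial>M) = (\<integral>\<^sup>+y. g (x, y) * indicator A x \<partial>M)"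
        by (intro nn_integral_cong) (auto simp: indicator_def)
      also have "\<dots> = indicator A x"
        using fst1[of x] by (subst nn_integral_multc) (auto simp: sp)
      finally show "(\<integral>\<^sup>+y. g (x, y) * indicator (A \<times> UNIV) (x, y) \<partial>M) = indicator A x" .
    qed
    finally show "emeasure (distr ?P borel fst) A = emeasure N A" by simp
  qed (simp add: s)
  have sn: "distr ?P borel snd = M"
  proof (rule measure_eqI)
    fix A assume "A \<in> sets (distr ?P borel snd)"
    then have A: "A \<in> sets borel" by simp
    then have [measurable]: "A \<in> sets M" using s by simp
    have A': "UNIV \<times> A \<in> sets (N \<Otimes>\<^sub>M M)"
      using pair_measureI[of UNIV N A M] A s by simp
    have "emeasure (distr ?P borel snd) A = emeasure ?P (UNIV \<times> A)"
      using A by (subst emeasure_distr) (auto simp: spNM intro!: arg_cong[of _ _ "emeasure ?P"])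
    also have "\<dots> = (\<integral>\<^sup>+z. g z * indicator (UNIV \<times> A) z \<partial>(N \<Otimes>\<^sub>M M))"
      by (rule emeasure_density[OF g' A'])
    also have "\<dots> = (\<integral>\<^sup>+y. \<integral>\<^sup>+x. g (x, y) * indicator (UNIV \<times> A) (x, y) \<partial>N \<partial>M)"
      using A' by (subst NM.nn_integral_snd[symmetric]) auto
    also have "\<dots> = (\<integral>\<^sup>+y. indicator A y \<partial>M)"
    proof (intro nn_integral_cong)
      fix y
      have "(\<integral>\<^sup>+x. g (x, y) * indicator (UNIV \<times> A) (x, y) \<partial>N) = (\<integral>\<^sup>+x. g (x, y) * indicator A y \<partial>N)"
        by (intro nn_integral_cong) (auto simp: indicator_def)
      also have "\<dots> = indicator A y"
        using snd1[of y] by (subst nn_integral_multc) (auto simp: sp)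
      finally show "(\<integral>\<^sup>+x. g (x, y) * indicator (UNIV \<times> A) (x, y) \<partial>N) = indicator A y" .
    qed
    finally show "emeasure (distr ?P borel snd) A = emeasure M A" by simp
  qed (simp add: s)
  have "emeasure ?P (space ?P) = emeasure (distr ?P borel fst) UNIV"
    by (subst emeasure_distr) (auto simp: spNM)
  also have "\<dots> = 1" using f N.emeasure_space_1 sp by simp
  finally have "prob_space ?P" by (rule prob_spaceI)
  then show "?P \<in> couplings N M" unfolding couplings_def using f sn sP by simp
  have d: "(\<lambda>z. ennreal (dist (fst z) (snd z) powr p)) \<in> borel_measurable (N \<Otimes>\<^sub>M M)"
  proof -
    have [measurable]: "(\<lambda>z::'a \<times> 'a. dist (fst z) (snd z)) \<in> borel_measurable borel"
      by (intro borel_measurable_continuous_onI continuous_intros)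
    have "(\<lambda>z::'a \<times> 'a. ennreal (dist (fst z) (snd z) powr p)) \<in> borel_measurable borel" by measurable
    then show ?thesis by (simp add: sP cong: measurable_cong_sets)
  qed
  have "cost p ?P = (\<integral>\<^sup>+z. g z * ennreal (dist (fst z) (snd z) powr p) \<partial>(N \<Otimes>\<^sub>M M))"
    by (rule nn_integral_density[OF g' d])
  also have "\<dots> = (\<integral>\<^sup>+x. \<integral>\<^sup>+y. g (x, y) * ennreal (dist x y powr p) \<partial>M \<partial>N)"
    using d by (subst M.nn_integral_fst[symmetric]) auto
  finally show "cost p ?P = (\<integral>\<^sup>+x. \<integral>\<^sup>+y. g (x, y) * ennreal (dist x y powr p) \<partial>M \<partial>N)" .
qed

lemma nn_integral_le_integral:
  assumes "integrable M h" "\<And>x. 0 \<le> h x" "\<And>x. f x \<le> ennreal (h x)"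
  shows "(\<integral>\<^sup>+x. f x \<partial>M) \<le> ennreal (integral\<^sup>L M h)"
  using nn_integral_mono[of M f "\<lambda>x. ennreal (h x)"] assms by (simp add: nn_integral_eq_integral)

text \<open>The product coupling has finite cost. This excludes the degenerate case of
  \<open>wasserstein\<close>, where \<open>enn2real\<close> would send an infinite infimum to 0 and
  a vanishing distance would say nothing.\<close>

lemma Inf_cost_finite:
  fixes N M :: "'a::euclidean_space measure"
  assumes p: "p \<ge> 1" and N: "N \<in> Pp p" and M: "M \<in> Pp p"
  shows "(INF \<pi>\<in>couplings N M. cost p \<pi>) < \<infinity>"
proof -
  interpret N: prob_space N using N PpD by blast
  interpret M: prob_space M using M PpD by blast
  note iN = PpD(4)[OF N] and iM = PpD(4)[OF M]
  let ?P = "density (N \<Otimes>\<^sub>M M) (\<lambda>_. 1)"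
  have 1: "?P \<in> couplings N M"
    "cost p ?P = (\<integral>\<^sup>+x. \<integral>\<^sup>+y. 1 * ennreal (dist x y powr p) \<partial>M \<partial>N)"
    by (rule density_coupling[OF N M]; simp add: N.emeasure_space_1 M.emeasure_space_1)+
  have "(\<integral>\<^sup>+y. 1 * ennreal (dist x y powr p) \<partial>M) \<le> ennreal (2 powr p * (pw x p + integ M (\<lambda>x. pw x p)))" for x
  proof -
    have "(\<integral>\<^sup>+y. 1 * ennreal (dist x y powr p) \<partial>M) \<le> ennreal (integ M (\<lambda>y. 2 powr p * (pw x p + pw y p)))"
      using dist_powr_le[OF p, of x _ 0] iM by (intro nn_integral_le_integral) auto
    then show ?thesis using iM by (simp add: M.prob_space)
  qed
  then have "cost p ?P \<le> ennreal (integ N (\<lambda>x. 2 powr p * (pw x p + integ M (\<lambda>x. pw x p))))"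
    unfolding 1(2) using iN by (intro nn_integral_le_integral) auto
  also have "\<dots> < \<infinity>" by simp
  finally show ?thesis using INF_lower[OF 1(1), of "cost p"] by (meson order_le_less_trans)
qed

text \<open>Under a nearly optimal coupling the increment of \<open>\<phi>\<close> is split by
  cases: uniform continuity for close pairs in a ball, the transport cost for distant pairs, and the
  tail weight of the second point otherwise. The tail is thus taken only under the fixed measure
  \<open>M\<close>.\<close>

lemma pweak_if_wasserstein_tendsto:
  fixes M :: "'a::euclidean_space measure"
  assumes p: "p \<ge> 1" and Ms: "\<And>n. Ms n \<in> Pp p" and M: "M \<in> Pp p"
    and W: "(\<lambda>n. wasserstein p (Ms n) M) \<longlonglongrightarrow> 0"
  shows "pweak p Ms M"
  unfolding pweak_def
proof (intro allI impI)
  fix \<phi> :: "'a \<Rightarrow> real" assume g: "pgrowth p \<phi>"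
  note p' = disjI2[OF p, of "p = 0"]
  obtain C where bd: "\<And>x. \<bar>\<phi> x\<bar> \<le> C * (1 + pw x p)" and cont: "continuous_on UNIV \<phi>"
    using g unfolding pgrowth_def by auto
  have C0: "0 \<le> C"
    using order_trans[OF abs_ge_zero bd[of 0]] one_plus_pw_pos[of "0::'a" p]
    by (simp add: zero_le_mult_iff)
  define c where "c n = enn2real (INF \<pi>\<in>couplings (Ms n) M. cost p \<pi>)" for n
  have "(\<lambda>n. wasserstein p (Ms n) M powr p) \<longlonglongrightarrow> 0"
    using W p by (intro tendsto_zero_powrI[where b = p]) (auto simp: wasserstein_def)
  moreover have "wasserstein p (Ms n) M powr p = c n" for n
    using p by (simp add: wasserstein_def c_def powr_powr)
  ultimately have c: "c \<longlonglongrightarrow> 0" by simp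
  have "\<exists>\<pi>\<in>couplings (Ms n) M. cost p \<pi> < ennreal (c n + e)" if "0 < e" for n e
  proof -
    have "(INF \<pi>\<in>couplings (Ms n) M. cost p \<pi>) = ennreal (c n)"
      unfolding c_def using Inf_cost_finite[OF p Ms M] by simp
    also have "\<dots> < ennreal (c n + e)" using that by (simp add: ennreal_lessI c_def add_nonneg_pos)
    finally show ?thesis by (simp add: INF_less_iff)
  qed
  note ex = this
  show "(\<lambda>n. integ (Ms n) \<phi>) \<longlonglongrightarrow> integ M \<phi>"
  proof (rule LIMSEQ_I)
    fix \<eta> :: real assume eta: "0 < \<eta>"
    \<comment> \<open>Large enough to absorb the growth bounds at both points once
      \<open>pw x p\<close> is estimated by \<open>2 powr p * (dist x y powr p + pw y p)\<close>;
      the final 1 makes it positive even for \<open>C = 0\<close>.\<close>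
    define C' where "C' = C * (3 + 2 * 2 powr p) + 1"
    have C': "0 < C'" using C0 by (auto simp: C'_def intro!: add_nonneg_pos mult_nonneg_nonneg add_nonneg_nonneg)
    have base: "\<bar>\<phi> x - \<phi> y\<bar> \<le> C' * (1 + pw y p + dist x y powr p)" for x y
    proof -
      have "pw x p \<le> 2 powr p * (pw (x - y) p + pw y p)"
        using pw_add_le[OF p', of "x - y" y] by simp
      moreover have "pw (x - y) p = dist x y powr p" using p by (simp add: pw_def dist_norm)
      ultimately have px: "pw x p \<le> 2 powr p * (dist x y powr p + pw y p)" by simp
      let ?d = "dist x y powr p" and ?y = "pw y p" and ?k = "2 powr p"
      have "(1 + pw x p) + (1 + pw y p) \<le> 2 + ?y + ?k * ?d + ?k * ?y"
        using px by (simp add: distrib_left)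
      also have "\<dots> \<le> (3 + 2 * ?k) * (1 + ?y + ?d)"
      proof -
        have "0 \<le> ?k * ?d" "0 \<le> ?k * ?y" "0 \<le> ?d" "0 \<le> ?y" "0 \<le> ?k" by auto
        moreover have "(3 + 2 * ?k) * (1 + ?y + ?d) = 3 + 3 * ?y + 3 * ?d + 2 * ?k + 2 * (?k * ?y) + 2 * (?k * ?d)"
          by (simp add: algebra_simps)
        ultimately show ?thesis by linarith
      qed
      finally have "C * ((1 + pw x p) + (1 + pw y p)) \<le> C * ((3 + 2 * ?k) * (1 + ?y + ?d))"
        using C0 by (rule mult_left_mono)
      moreover have "0 \<le> 1 + ?y + ?d" by (simp add: add_nonneg_nonneg)
      moreover have "C' * (1 + ?y + ?d) = C * ((3 + 2 * ?k) * (1 + ?y + ?d)) + (1 + ?y + ?d)"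
        unfolding C'_def by (simp only: distrib_right mult_1 mult.assoc)
      moreover have "\<bar>\<phi> x - \<phi> y\<bar> \<le> C * ((1 + pw x p) + (1 + pw y p))"
        using bd[of x] bd[of y] unfolding distrib_left[of C "1 + pw x p"] by linarith
      ultimately show ?thesis by linarith
    qed
    have "0 < \<eta> / (4 * C')" using eta C' by simp
    then obtain R where R: "1 \<le> R" "integ M (tail_weight p R) < \<eta> / (4 * C')"
      using tail_weight_small[OF p' M] by blast
    \<comment> \<open>The point \<open>y\<close> has norm at most \<open>R + 1\<close> and
      \<open>x\<close> lies within \<open>\<delta> \<le> 1\<close> of it.\<close>
    have "uniformly_continuous_on (cball 0 (R + 2)) \<phi>"
      using cont by (intro compact_uniformly_continuous) (auto intro: continuous_on_subset)
    moreover have "0 < \<eta> / 4" using eta by simp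
    ultimately have "\<exists>d>0. \<forall>x\<in>cball 0 (R + 2). \<forall>x'\<in>cball 0 (R + 2). dist x' x < d \<longrightarrow> dist (\<phi> x') (\<phi> x) < \<eta> / 4"
      unfolding uniformly_continuous_on_def by blast
    then obtain \<delta>0 where d0: "0 < \<delta>0"
      "\<And>x y. x \<in> cball 0 (R + 2) \<Longrightarrow> y \<in> cball 0 (R + 2) \<Longrightarrow> dist x y < \<delta>0 \<Longrightarrow> \<bar>\<phi> x - \<phi> y\<bar> < \<eta> / 4"
      unfolding dist_real_def by blast
    define \<delta> where "\<delta> = min \<delta>0 1"
    have d: "0 < \<delta>" "\<delta> \<le> 1" "\<delta> \<le> \<delta>0" using d0 by (auto simp: \<delta>_def)
    \<comment> \<open>For \<open>dist x y \<ge> \<delta>\<close> and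
      \<open>norm y \<le> R + 1\<close> the whole growth bound is paid by the cost, since 1 is at
      most \<open>dist x y powr p / \<delta> powr p\<close>.\<close>
    define K where "K = C' * ((1 + (R + 1) powr p) / \<delta> powr p + 1)"
    have K0: "0 < K" unfolding K_def using C' d
      by (intro mult_pos_pos add_nonneg_pos divide_nonneg_nonneg) (auto simp: add_nonneg_nonneg)
    have pt: "\<bar>\<phi> x - \<phi> y\<bar> \<le> \<eta> / 4 + K * dist x y powr p + C' * tail_weight p R y" for x y
    proof -
      have n1: "0 \<le> K * dist x y powr p" "0 \<le> C' * tail_weight p R y"
        using K0 C' tail_weight_nonneg[of p R y] by auto
      consider "norm y \<le> R + 1" "dist x y < \<delta>" | "norm y \<le> R + 1" "\<delta> \<le> dist x y" | "R + 1 < norm y"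
        by linarith
      then show ?thesis
      proof cases
        case 1
        have "norm x \<le> norm y + dist x y" by (metis dist_norm norm_triangle_sub)
        then have "\<bar>\<phi> x - \<phi> y\<bar> < \<eta> / 4" using 1 d by (intro d0) auto
        then show ?thesis using n1 by linarith
      next
        case 2
        have q: "pw y p \<le> (R + 1) powr p" using 2 p by (auto simp: pw_def intro!: powr_mono2)
        have dd: "1 \<le> dist x y powr p / \<delta> powr p"
          using 2 d p powr_mono2[of p \<delta> "dist x y"] by (simp add: le_divide_eq)
        have "1 + pw y p \<le> (1 + (R + 1) powr p) * 1" using q by simp
        also have "\<dots> \<le> (1 + (R + 1) powr p) * (dist x y powr p / \<delta> powr p)"
          using dd by (intro mult_left_mono) (auto simp: add_nonneg_nonneg)
        finally have "1 + pw y p + dist x y powr p \<le> ((1 + (R + 1) powr p) / \<delta> powr p + 1) * dist x y powr p"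
          by (simp add: algebra_simps)
        then have "C' * (1 + pw y p + dist x y powr p) \<le> K * dist x y powr p"
          using mult_left_mono[of _ _ C'] C' unfolding K_def by (simp add: mult.assoc)
        then show ?thesis using base[of x y] n1 eta by linarith
      next
        case 3
        have "1 + pw y p \<le> tail_weight p R y" using 3 by (intro tail_weight_ge) auto
        then have t: "C' * (1 + pw y p) \<le> C' * tail_weight p R y" using C' by (intro mult_left_mono) auto
        have "C' * 1 \<le> K" unfolding K_def using C' by (intro mult_left_mono) (auto simp: add_nonneg_nonneg)
        then have "C' * dist x y powr p \<le> K * dist x y powr p" by (intro mult_right_mono) auto
        then show ?thesis using base[of x y] t eta by (simp add: algebra_simps)
      qed
    qed
    have "\<forall>\<^sub>F n in sequentially. c n < \<eta> / (8 * K)"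
      using c eta K0 by (intro order_tendstoD) auto
    then obtain n0 where n0: "\<And>n. n \<ge> n0 \<Longrightarrow> c n < \<eta> / (8 * K)" unfolding eventually_sequentially by auto
    have "norm (integ (Ms n) \<phi> - integ M \<phi>) < \<eta>" if n: "n \<ge> n0" for n
    proof -
      \<comment> \<open>The infimum need not be attained. This slack and the equal bound on
        \<open>c n\<close> leave a cost below \<open>\<eta> / (4 * K)\<close>, so that the cost term
        contributes less than a quarter of \<open>\<eta>\<close>.\<close>
      have "0 < \<eta> / (8 * K)" using eta K0 by simp
      then obtain \<pi> where pi: "\<pi> \<in> couplings (Ms n) M" "cost p \<pi> < ennreal (c n + \<eta> / (8 * K))"
        using ex by blast
      have "c n + \<eta> / (8 * K) \<le> \<eta> / (8 * K) + \<eta> / (8 * K)" using n0[OF n] by simp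
      also have "\<dots> = \<eta> / (4 * K)" by simp
      finally have pic: "cost p \<pi> < ennreal (\<eta> / (4 * K))"
        using pi(2) by (meson ennreal_leI order_less_le_trans)
      interpret pi: prob_space \<pi> using pi(1) unfolding couplings_def by simp
      have s: "sets \<pi> = sets borel" and f: "distr \<pi> borel fst = Ms n" and sn: "distr \<pi> borel snd = M"
        using pi(1) unfolding couplings_def by auto
      have mf: "fst \<in> measurable \<pi> borel" "snd \<in> measurable \<pi> borel"
        by (auto simp: s intro!: borel_measurable_continuous_onI continuous_intros cong: measurable_cong_sets)
      have mphi: "\<phi> \<in> borel_measurable borel" using pgrowth_measurable[OF g] .
      have mt: "tail_weight p R \<in> borel_measurable (borel :: 'a measure)" using pgrowth_measurable[OF pgrowth_tail_weight[OF p']] .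
      have i1: "integrable \<pi> (\<lambda>z. \<phi> (fst z))"
        using pgrowth_integrable[OF Ms[of n] g] unfolding f[symmetric]
        by (subst (asm) integrable_distr_eq) (use mf mphi in auto)
      have i2: "integrable \<pi> (\<lambda>z. \<phi> (snd z))" and i3: "integrable \<pi> (\<lambda>z. tail_weight p R (snd z))"
        using pgrowth_integrable[OF M g] pgrowth_integrable[OF M pgrowth_tail_weight[OF p']] unfolding sn[symmetric]
        by (subst (asm) integrable_distr_eq, use mf mphi mt in auto)+
      have md: "(\<lambda>z. dist (fst z) (snd z) powr p) \<in> borel_measurable \<pi>"
        using mf by measurable
      have i4: "integrable \<pi> (\<lambda>z. dist (fst z) (snd z) powr p)"
        using pic md by (intro integrableI_nonneg) (auto intro: order_less_trans)
      have ed: "integral\<^sup>L \<pi> (\<lambda>z. dist (fst z) (snd z) powr p) < \<eta> / (4 * K)"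
        using pic eta K0 by (subst (asm) nn_integral_eq_integral[OF i4]) (auto simp: ennreal_less_iff)
      have e1: "integ (Ms n) \<phi> = integral\<^sup>L \<pi> (\<lambda>z. \<phi> (fst z))"
        unfolding f[symmetric] using mf mphi by (intro integral_distr) auto
      have e2: "integ M \<phi> = integral\<^sup>L \<pi> (\<lambda>z. \<phi> (snd z))" "integ M (tail_weight p R) = integral\<^sup>L \<pi> (\<lambda>z. tail_weight p R (snd z))"
        unfolding sn[symmetric] using mf mphi mt by (auto intro!: integral_distr)
      have "\<bar>integ (Ms n) \<phi> - integ M \<phi>\<bar> = \<bar>integral\<^sup>L \<pi> (\<lambda>z. \<phi> (fst z) - \<phi> (snd z))\<bar>"
        using i1 i2 e1 e2 by simp
      also have "\<dots> \<le> integral\<^sup>L \<pi> (\<lambda>z. \<bar>\<phi> (fst z) - \<phi> (snd z)\<bar>)" by simp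
      also have "\<dots> \<le> integral\<^sup>L \<pi> (\<lambda>z. \<eta> / 4 + K * dist (fst z) (snd z) powr p + C' * tail_weight p R (snd z))"
        using i1 i2 i3 i4 pt by (intro integral_mono) auto
      also have "\<dots> = \<eta> / 4 + K * integral\<^sup>L \<pi> (\<lambda>z. dist (fst z) (snd z) powr p) + C' * integ M (tail_weight p R)"
        using i3 i4 e2(2) by (simp add: pi.prob_space)
      also have "\<dots> < \<eta> / 4 + K * (\<eta> / (4 * K)) + C' * (\<eta> / (4 * C'))"
        using K0 C' ed R by (intro add_strict_mono mult_strict_left_mono add_strict_left_mono) auto
      also have "\<dots> = 3 * \<eta> / 4" using K0 C' by simp
      finally show ?thesis using eta by simp
    qed
    then show "\<exists>no. \<forall>n\<ge>no. norm (integ (Ms n) \<phi> - integ M \<phi>) < \<eta>" by blast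
  qed
qed

section \<open>Transport cost through the atoms of a partition of unity\<close>

lemma quantizer_cost_le:
  fixes x :: "'a::euclidean_space"
  assumes p: "p \<ge> 1" and q: "quantizer p R m xs \<psi> \<epsilon>"
  shows "(\<Sum>i<m. \<psi> i x * pw (x - xs i) p) \<le> 2 powr p * (3 + 2 powr p) * (1 + pw x p)"
proof -
  note p' = disjI2[OF p, of "p = 0"]
  have "(\<Sum>i<m. \<psi> i x * pw (x - xs i) p) \<le> (\<Sum>i<m. \<psi> i x * (2 powr p * (pw x p + pw (xs i) p)))"
  proof (intro sum_mono mult_left_mono)
    fix i assume "i \<in> {..<m}"
    have "pw (x - xs i) p \<le> 2 powr p * (pw x p + pw (- xs i) p)"
      using pw_add_le[OF p', of x "- xs i"] by simp
    then show "pw (x - xs i) p \<le> 2 powr p * (pw x p + pw (xs i) p)" by simp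
  qed (use quantizerD(6)[OF q] in \<open>auto intro: less_imp_le\<close>)
  also have "\<dots> = 2 powr p * ((\<Sum>i<m. \<psi> i x) * pw x p + qavg m xs \<psi> (\<lambda>z. pw z p) x)"
    by (simp add: qavg_def sum_distrib_left sum_distrib_right sum.distrib[symmetric] algebra_simps)
  also have "\<dots> \<le> 2 powr p * (1 * (1 + pw x p) + (2 + 2 powr p) * (1 + pw x p))"
  proof (intro mult_left_mono add_mono)
    show "(\<Sum>i<m. \<psi> i x) * pw x p \<le> 1 * (1 + pw x p)" by (simp add: quantizerD(8)[OF q])
    show "qavg m xs \<psi> (\<lambda>z. pw z p) x \<le> (2 + 2 powr p) * (1 + pw x p)"
      using qavg_growth[OF p' q, of "\<lambda>z. pw z p" 1 x] by simp
  qed auto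
  also have "\<dots> = 2 powr p * (3 + 2 powr p) * (1 + pw x p)" by (simp add: algebra_simps)
  finally show ?thesis .
qed

text \<open>The integrand is the cost of spreading a unit mass at \<open>x\<close> over the atoms
  with weights \<open>\<psi> i x\<close>. It vanishes pointwise as the partition is refined, and
  \<open>quantizer_cost_le\<close> supplies a dominating function independent of the level.\<close>

lemma quantizer_cost_small:
  fixes M :: "'a::euclidean_space measure"
  assumes p: "p \<ge> 1" and M: "M \<in> Pp p" and eta: "0 < \<eta>"
  shows "\<exists>R m xs \<psi> \<epsilon>. quantizer p R m xs \<psi> \<epsilon> \<and> integ M (\<lambda>x. \<Sum>i<m. \<psi> i x * pw (x - xs i) p) < \<eta>"
proof -
  note p' = disjI2[OF p, of "p = 0"]
  have "\<forall>n::nat. \<exists>m xs \<psi> \<epsilon>. quantizer p (real (Suc n)) m (xs :: nat \<Rightarrow> 'a) \<psi> \<epsilon>"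
    by (intro allI quantizer_exists) simp
  then obtain m xs \<psi> \<epsilon> where q: "\<And>n::nat. quantizer p (real (Suc n)) (m n) (xs n :: nat \<Rightarrow> 'a) (\<psi> n) (\<epsilon> n)"
    by metis
  let ?c = "\<lambda>n x. \<Sum>i<m n. \<psi> n i x * pw (x - xs n i) p"
  have "(\<lambda>n. integ M (?c n)) \<longlonglongrightarrow> integ M (\<lambda>x. 0)"
  proof (rule integral_dominated_convergence[where w = "\<lambda>x. 2 powr p * (3 + 2 powr p) * (1 + pw x p)"])
    show "integrable M (\<lambda>x. 2 powr p * (3 + 2 powr p) * (1 + pw x p))"
      using pgrowth_integrable[OF M pgrowth_pw[OF p']] by simp
    show "?c n \<in> borel_measurable M" for n
      using quantizerD(4)[OF q]
      by (intro Pp_measurable[OF M] borel_measurable_continuous_onI continuous_intros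
            continuous_on_compose2[OF continuous_on_pw[OF p']]) auto
    show "AE x in M. norm (?c n x) \<le> 2 powr p * (3 + 2 powr p) * (1 + pw x p)" for n
    proof (intro AE_I2)
      fix x
      have "0 \<le> ?c n x" using quantizerD(6)[OF q]
        by (intro sum_nonneg mult_nonneg_nonneg) (auto intro: less_imp_le)
      then show "norm (?c n x) \<le> 2 powr p * (3 + 2 powr p) * (1 + pw x p)"
        using quantizer_cost_le[OF p q, where x = x] by simp
    qed
    have "(\<lambda>n. ?c n x) \<longlonglongrightarrow> 0" for x
    proof -
      \<comment> \<open>With \<open>x\<close> frozen in \<open>u\<close>, the cost at
        \<open>x\<close> becomes an average of a fixed function, evaluated at the same
        \<open>x\<close>; its limit is \<open>u x = 0\<close>.\<close>
      define u where "u z = pw (x - z) p" for z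
      have c: "?c n x = qavg (m n) (xs n) (\<psi> n) u x" for n by (simp add: qavg_def u_def)
      have "continuous_on UNIV u" unfolding u_def
        by (intro continuous_intros continuous_on_compose2[OF continuous_on_pw[OF p']]) auto
      then have "cconv (\<lambda>n. u) u" by (rule cconv_const)
      moreover have "\<bar>u z\<bar> \<le> (2 powr p * (1 + pw x p)) * (1 + pw z p)" for z
      proof -
        have "u z \<le> 2 powr p * (pw x p + pw (- z) p)" using pw_add_le[OF p', of x "- z"] by (simp add: u_def)
        also have "\<dots> \<le> 2 powr p * ((1 + pw x p) * (1 + pw z p))"
          by (intro mult_left_mono) (auto simp: pw_def algebra_simps)
        finally show ?thesis by (simp add: u_def mult.assoc)
      qed
      moreover have "filterlim (\<lambda>n. real (Suc n)) at_top sequentially"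
        by (rule filterlim_compose[OF filterlim_real_sequentially filterlim_Suc])
      ultimately have "cconv (\<lambda>n. qavg (m n) (xs n) (\<psi> n) u) u"
        by (intro qavg_cconv[OF p' q]) auto
      from cconv_pointwise[OF this, of x] show ?thesis
        using p unfolding c by (simp add: u_def pw_def)
    qed
    then show "AE x in M. (\<lambda>n. ?c n x) \<longlonglongrightarrow> 0" by simp
  qed auto
  then have "\<forall>\<^sub>F n in sequentially. integ M (?c n) < \<eta>"
    using eta by (intro order_tendstoD(2)[of _ 0]) auto
  then obtain n where "integ M (?c n) < \<eta>" unfolding eventually_sequentially by auto
  then show ?thesis using q by blast
qed


text \<open>With \<open>a i = N(\<psi> i)\<close>, \<open>b i = M(\<psi> i)\<close> and \<open>l = 1 - \<eta>\<close>, the coupling has the density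
  \<open>l * (\<Sum>i. \<psi> i x * \<psi> i y / a i) + (1 - l * (\<Sum>i. b i / a i * \<psi> i x))\<close> with respect to the product of N and M: most of the mass
  is transported within the cells of the partition, the rest independently.\<close>

lemma Inf_cost_le:
  fixes N M :: "'a::euclidean_space measure"
  assumes p: "p \<ge> 1" and N: "N \<in> Pp p" and M: "M \<in> Pp p" and q: "quantizer p R m xs \<psi> \<epsilon>"
    and eta: "0 < \<eta>" "\<eta> < 1"
    and close: "\<And>i. i < m \<Longrightarrow> (1 - \<eta>) * integ M (\<psi> i) \<le> integ N (\<psi> i)"
      "\<And>i. i < m \<Longrightarrow> (1 - \<eta>) * integ N (\<psi> i) \<le> integ M (\<psi> i)"
  shows "(INF \<pi>\<in>couplings N M. cost p \<pi>) \<le>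
    ennreal (2 powr p * (integ N (\<lambda>x. \<Sum>i<m. \<psi> i x * pw (x - xs i) p) + integ M (\<lambda>x. \<Sum>i<m. \<psi> i x * pw (x - xs i) p))
      + 2 * \<eta> * 2 powr p * (integ N (\<lambda>x. pw x p) + integ M (\<lambda>x. pw x p)))"
proof -
  note p' = disjI2[OF p, of "p = 0"]
  interpret N: prob_space N using N PpD by blast
  interpret M: prob_space M using M PpD by blast
  define a where "a i = integ N (\<psi> i)" for i
  define b where "b i = integ M (\<psi> i)" for i
  define d where "d i x = pw (x - xs i) p" for i x
  define l where "l = 1 - \<eta>"
  define k where "k = 2 powr p"
  have l: "0 < l" "l \<le> 1" using eta by (auto simp: l_def)
  have k: "0 < k" by (simp add: k_def)
  have ap: "0 < a i" and bp: "0 < b i" if "i < m" for i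
    using quantizer_weights(4)[OF q _ that] N M by (auto simp: a_def b_def)
  have a1: "(\<Sum>i<m. a i) = 1" and b1: "(\<Sum>i<m. b i) = 1"
    using quantizer_weights(1)[OF q] N M by (auto simp: a_def b_def)
  have psi: "0 \<le> \<psi> i x" "\<psi> i x \<le> 1" if "i < m" for i x
    using quantizerD(6,10)[OF q that] by (auto intro: less_imp_le)
  have ab: "l * (b i / a i) \<le> 1" "l \<le> b i / a i" if "i < m" for i
    using close[OF that] ap[OF that] by (auto simp: a_def b_def l_def field_simps)
  have g1: "pgrowth p (\<psi> i)" if "i < m" for i using quantizer_pgrowth[OF q that] .
  have g2: "pgrowth p (\<lambda>x. \<psi> i x * d i x)" if "i < m" for i
    unfolding d_def using quantizerD(4)[OF q that] psi[OF that]
    by (intro pgrowth_bounded_mult[OF pgrowth_pw_shift[OF p'], of _ 1]) auto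
  have iN: "integrable N (\<psi> i)" "integrable N (\<lambda>x. \<psi> i x * d i x)" if "i < m" for i
    using pgrowth_integrable[OF N] g1 g2 that by auto
  have iM: "integrable M (\<psi> i)" "integrable M (\<lambda>x. \<psi> i x * d i x)" if "i < m" for i
    using pgrowth_integrable[OF M] g1 g2 that by auto
  have d0: "0 \<le> d i x" for i x by (simp add: d_def)
  have iP: "integrable N (\<lambda>x. pw x p)" "integrable M (\<lambda>x. pw x p)" using PpD N M by blast+
  have hN: "i < m \<Longrightarrow> has_bochner_integral N (\<psi> i) (a i)"
      "i < m \<Longrightarrow> has_bochner_integral N (\<lambda>x. \<psi> i x * d i x) (integ N (\<lambda>x. \<psi> i x * d i x))"
      "has_bochner_integral N (\<lambda>x. pw x p) (integ N (\<lambda>x. pw x p))"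
      "has_bochner_integral N (\<lambda>x. c) c" for i and c :: real
    using iN iP by (auto simp: has_bochner_integral_iff a_def N.prob_space)
  have hM: "i < m \<Longrightarrow> has_bochner_integral M (\<psi> i) (b i)"
      "i < m \<Longrightarrow> has_bochner_integral M (\<lambda>x. \<psi> i x * d i x) (integ M (\<lambda>x. \<psi> i x * d i x))"
      "has_bochner_integral M (\<lambda>x. pw x p) (integ M (\<lambda>x. pw x p))"
      "has_bochner_integral M (\<lambda>x. c) c" for i and c :: real
    using iM iP by (auto simp: has_bochner_integral_iff b_def M.prob_space)
  \<comment> \<open>Density of the independent part, chosen as the deficit of the cell part in the
    first marginal. The two closeness hypotheses give \<open>l * (b i / a i) \<le> 1\<close>, hence
    \<open>0 \<le> r x\<close>, and \<open>l \<le> b i / a i\<close>, hence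
    \<open>r x \<le> 1 - l * l \<le> 2 * \<eta>\<close>.\<close>
  define r where "r x = 1 - l * (\<Sum>i<m. b i / a i * \<psi> i x)" for x
  define g where "g x y = l * (\<Sum>i<m. \<psi> i x * \<psi> i y / a i) + r x" for x y
  have r: "0 \<le> r x" "r x \<le> 2 * \<eta>" for x
  proof -
    have "(\<Sum>i<m. l * (b i / a i) * \<psi> i x) \<le> (\<Sum>i<m. 1 * \<psi> i x)"
      using ab psi by (intro sum_mono mult_right_mono) auto
    then show "0 \<le> r x" using quantizerD(8)[OF q] by (simp add: r_def sum_distrib_left mult.assoc)
    have "(\<Sum>i<m. l * \<psi> i x) \<le> (\<Sum>i<m. b i / a i * \<psi> i x)"
      using ab psi by (intro sum_mono mult_right_mono) auto
    then have "l \<le> (\<Sum>i<m. b i / a i * \<psi> i x)"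
      using quantizerD(8)[OF q] by (simp add: sum_distrib_left[symmetric])
    then have "l * l \<le> l * (\<Sum>i<m. b i / a i * \<psi> i x)" using l by (intro mult_left_mono) auto
    moreover have "l * l = 1 - 2 * \<eta> + \<eta> * \<eta>" by (simp add: l_def algebra_simps)
    ultimately show "r x \<le> 2 * \<eta>" unfolding r_def using mult_pos_pos[OF eta(1) eta(1)] by linarith
  qed
  have g0: "0 \<le> g x y" for x y
    unfolding g_def using l r[of x] psi ap
    by (intro add_nonneg_nonneg mult_nonneg_nonneg sum_nonneg divide_nonneg_nonneg) (auto intro: less_imp_le)
  have meas: "(\<lambda>z. ennreal (g (fst z) (snd z))) \<in> borel_measurable borel"
    unfolding g_def r_def
    by (intro measurable_compose[OF _ measurable_ennreal] borel_measurable_continuous_onI continuous_intros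
          continuous_on_compose2[OF quantizerD(4)[OF q]]) (use ap in \<open>auto simp: less_imp_neq[symmetric]\<close>)
  have F1: "(\<integral>\<^sup>+y. ennreal (g x y) \<partial>M) = 1" for x
  proof -
    have hb: "has_bochner_integral M (\<lambda>y. g x y) (l * (\<Sum>i<m. \<psi> i x * b i / a i) + r x)"
      unfolding g_def by (intro has_bochner_integral_add has_bochner_integral_diff has_bochner_integral_sum has_bochner_integral_mult_right has_bochner_integral_mult_left has_bochner_integral_divide hM) auto
    then have i: "integrable M (\<lambda>y. g x y)" by (simp add: has_bochner_integral_iff)
    have "integ M (\<lambda>y. g x y) = l * (\<Sum>i<m. \<psi> i x * b i / a i) + r x"
      using hb by (simp add: has_bochner_integral_iff)
    also have "\<dots> = 1" by (simp add: r_def mult.commute)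
    finally show ?thesis using i g0 by (simp add: nn_integral_eq_integral)
  qed
  \<comment> \<open>The other marginal is not built into \<open>r\<close>: dividing by
    \<open>a i\<close> turns the cell sum into the sum of the \<open>\<psi> i y\<close>, and the
    deficit integrates to \<open>1 - l\<close> because the \<open>b i\<close> sum to 1.\<close>
  have F2: "(\<integral>\<^sup>+x. ennreal (g x y) \<partial>N) = 1" for y
  proof -
    let ?I = "l * (\<Sum>i<m. a i * \<psi> i y / a i) + (1 - l * (\<Sum>i<m. b i / a i * a i))"
    have hb: "has_bochner_integral N (\<lambda>x. g x y) ?I"
      unfolding g_def r_def by (intro has_bochner_integral_add has_bochner_integral_diff has_bochner_integral_sum has_bochner_integral_mult_right has_bochner_integral_mult_left has_bochner_integral_divide hN) auto
    then have i: "integrable N (\<lambda>x. g x y)" by (simp add: has_bochner_integral_iff)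
    have "integ N (\<lambda>x. g x y) = ?I"
      using hb by (simp add: has_bochner_integral_iff)
    also have "(\<Sum>i<m. a i * \<psi> i y / a i) = (\<Sum>i<m. \<psi> i y)"
      using ap by (intro sum.cong) (auto simp: less_imp_neq[symmetric])
    also have "(\<Sum>i<m. b i / a i * a i) = (\<Sum>i<m. b i)"
      using ap by (intro sum.cong) (auto simp: less_imp_neq[symmetric])
    finally show ?thesis using i g0 b1 quantizerD(8)[OF q] by (simp add: nn_integral_eq_integral)
  qed
  \<comment> \<open>Within a cell the mass is routed through the atom \<open>xs i\<close>, in the
    independent part through the origin. Both routes cost at most \<open>k\<close> times a sum of a
    function of \<open>x\<close> and one of \<open>y\<close>, so everything integrates
    explicitly.\<close>
  define G where "G x y = l * (\<Sum>i<m. k / a i * (\<psi> i x * d i x * \<psi> i y + \<psi> i x * (\<psi> i y * d i y)))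
      + 2 * \<eta> * k * (pw x p + pw y p)" for x y
  have pt: "ennreal (g x y) * ennreal (dist x y powr p) \<le> ennreal (G x y)" for x y
  proof -
    have "g x y * dist x y powr p = l * (\<Sum>i<m. \<psi> i x * \<psi> i y / a i * dist x y powr p) + r x * dist x y powr p"
      by (simp add: g_def distrib_right sum_distrib_right mult.assoc)
    also have "\<dots> \<le> l * (\<Sum>i<m. \<psi> i x * \<psi> i y / a i * (k * (d i x + d i y))) + 2 * \<eta> * (k * (pw x p + pw y p))"
    proof (intro add_mono mult_left_mono sum_mono mult_mono)
      show "dist x y powr p \<le> k * (d i x + d i y)" for i
        unfolding d_def k_def by (rule dist_powr_le[OF p])
      show "dist x y powr p \<le> k * (pw x p + pw y p)"
        unfolding k_def using dist_powr_le[OF p, of x y 0] by simp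
    qed (use psi ap l r eta in \<open>auto simp: less_imp_le intro!: divide_nonneg_nonneg mult_nonneg_nonneg\<close>)
    also have "\<dots> = G x y"
      unfolding G_def by (simp add: algebra_simps add_divide_distrib)
    finally show ?thesis using g0 by (simp add: ennreal_mult''[symmetric] ennreal_leI)
  qed
  define H where "H x = l * (\<Sum>i<m. k / a i * (\<psi> i x * d i x * b i + \<psi> i x * integ M (\<lambda>y. \<psi> i y * d i y)))
      + 2 * \<eta> * k * (pw x p + integ M (\<lambda>y. pw y p))" for x
  have G0: "0 \<le> G x y" for x y unfolding G_def using l k psi ap eta d0
    by (intro add_nonneg_nonneg mult_nonneg_nonneg sum_nonneg divide_nonneg_nonneg) (auto intro: less_imp_le)
  have H1: "(\<integral>\<^sup>+y. ennreal (g x y) * ennreal (dist x y powr p) \<partial>M) \<le> ennreal (H x)" for x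
  proof -
    have hb: "has_bochner_integral M (G x) (H x)"
      unfolding G_def H_def by (intro has_bochner_integral_add has_bochner_integral_diff has_bochner_integral_sum has_bochner_integral_mult_right has_bochner_integral_mult_left has_bochner_integral_divide hM) auto
    then have i: "integrable M (G x)" by (simp add: has_bochner_integral_iff)
    have "(\<integral>\<^sup>+y. ennreal (g x y) * ennreal (dist x y powr p) \<partial>M) \<le> ennreal (integ M (G x))"
      by (rule nn_integral_le_integral[OF i G0 pt])
    also have "integ M (G x) = H x"
      using hb by (simp add: has_bochner_integral_iff)
    finally show ?thesis .
  qed
  have mono: "0 \<le> integ M (\<lambda>y. \<psi> i y * d i y)" "0 \<le> integ N (\<lambda>y. \<psi> i y * d i y)" if "i < m" for i
    using psi[OF that] d0 by (auto intro!: Bochner_Integration.integral_nonneg)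
  have H0: "0 \<le> H x" for x unfolding H_def using l k psi ap eta d0 bp mono
    by (intro add_nonneg_nonneg mult_nonneg_nonneg sum_nonneg divide_nonneg_nonneg) (auto intro: less_imp_le)
  let ?I = "l * (\<Sum>i<m. k / a i * (integ N (\<lambda>x. \<psi> i x * d i x) * b i + a i * integ M (\<lambda>y. \<psi> i y * d i y)))
      + 2 * \<eta> * k * (integ N (\<lambda>x. pw x p) + integ M (\<lambda>y. pw y p))"
  have hb: "has_bochner_integral N H ?I"
    unfolding H_def by (intro has_bochner_integral_add has_bochner_integral_diff has_bochner_integral_sum has_bochner_integral_mult_right has_bochner_integral_mult_left has_bochner_integral_divide hN) auto
  then have iH: "integrable N H" by (simp add: has_bochner_integral_iff)
  note C = density_coupling[OF N M meas, unfolded fst_conv snd_conv, OF F1 F2]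
  have "(INF \<pi>\<in>couplings N M. cost p \<pi>) \<le> cost p (density (N \<Otimes>\<^sub>M M) (\<lambda>z. ennreal (g (fst z) (snd z))))"
    by (rule INF_lower[OF C(1)])
  also have "\<dots> \<le> ennreal (integ N H)"
    unfolding C(2) by (rule nn_integral_le_integral[OF iH H0 H1])
  also have "integ N H = ?I"
    using hb by (simp add: has_bochner_integral_iff)
  also have "l * (\<Sum>i<m. k / a i * (integ N (\<lambda>x. \<psi> i x * d i x) * b i + a i * integ M (\<lambda>y. \<psi> i y * d i y)))
      = (\<Sum>i<m. k * (l * (b i / a i) * integ N (\<lambda>x. \<psi> i x * d i x) + l * integ M (\<lambda>y. \<psi> i y * d i y)))"
    unfolding sum_distrib_left using ap
    by (intro sum.cong refl) (auto simp: field_simps less_imp_neq[symmetric])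
  \<comment> \<open>Here the closeness of the weights enters the cost: the ratios
    \<open>b i / a i\<close> disappear and only the costs of spreading N and M over the atoms
    remain.\<close>
  also have "\<dots> \<le> (\<Sum>i<m. k * (1 * integ N (\<lambda>x. \<psi> i x * d i x) + 1 * integ M (\<lambda>y. \<psi> i y * d i y)))"
    using k ab l mono by (intro sum_mono mult_left_mono add_mono mult_right_mono) auto
  also have "\<dots> = k * (integ N (\<lambda>x. \<Sum>i<m. \<psi> i x * d i x) + integ M (\<lambda>x. \<Sum>i<m. \<psi> i x * d i x))"
    using iN iM by (simp add: Bochner_Integration.integral_sum sum.distrib[symmetric] sum_distrib_left)
  finally show ?thesis unfolding d_def k_def by (simp add: ennreal_leI)
qed

text \<open>A single quantizer, fine enough for \<open>M\<close>, is fixed. The spreading costs, the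
  moments and the finitely many weights are all integrals of growth-\<open>p\<close> functions, so
  \<open>Inf_cost_le\<close> applies to \<open>Ms n\<close> for all large \<open>n\<close>.\<close>

lemma wasserstein_tendsto_if_pweak:
  fixes M :: "'a::euclidean_space measure"
  assumes p: "p \<ge> 1" and Ms: "\<And>n. Ms n \<in> Pp p" and M: "M \<in> Pp p" and w: "pweak p Ms M"
  shows "(\<lambda>n. wasserstein p (Ms n) M) \<longlonglongrightarrow> 0"
proof -
  note p' = disjI2[OF p, of "p = 0"]
  have "(\<lambda>n. enn2real (INF \<pi>\<in>couplings (Ms n) M. cost p \<pi>)) \<longlonglongrightarrow> 0"
  proof (rule LIMSEQ_I)
    fix e :: real assume e: "0 < e"
    define k :: real where "k = 2 powr p"
    have k: "0 < k" by (simp add: k_def)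
    define B where "B = integ M (\<lambda>x. pw x p) + 1"
    have B: "0 < B" unfolding B_def by (intro add_nonneg_pos Bochner_Integration.integral_nonneg) auto
    \<comment> \<open>With both moments at most \<open>B\<close>, the independent part costs at most
      \<open>4 * \<eta> * k * B\<close>, a quarter of \<open>e\<close>; the two spreading costs give
      another quarter.\<close>
    define \<eta> where "\<eta> = min (1/2) (e / (16 * k * B))"
    have eta: "0 < \<eta>" "\<eta> < 1" "\<eta> \<le> e / (16 * k * B)" using e k B by (auto simp: \<eta>_def)
    have "0 < e / (8 * k)" using e k by simp
    then obtain R m xs \<psi> \<epsilon> where q: "quantizer p R m xs \<psi> \<epsilon>"
      and small: "integ M (\<lambda>x. \<Sum>i<m. \<psi> i x * pw (x - xs i) p) < e / (8 * k)"
      using quantizer_cost_small[OF p M] by blast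
    let ?c = "\<lambda>x. \<Sum>i<m. \<psi> i x * pw (x - xs i) p"
    have gc: "pgrowth p ?c"
      using quantizerD(4,6,10)[OF q]
      by (intro pgrowth_sum pgrowth_bounded_mult[OF pgrowth_pw_shift[OF p'], of _ 1])
         (auto simp: abs_of_pos)
    have gp: "pgrowth p (\<lambda>x::'a. pw x p)" using pgrowth_pw_shift[OF p', of 0] by simp
    have lim: "(\<lambda>n. integ (Ms n) \<phi>) \<longlonglongrightarrow> integ M \<phi>" if "pgrowth p \<phi>" for \<phi>
      using w that unfolding pweak_def by blast
    have "\<forall>\<^sub>F n in sequentially. integ (Ms n) ?c < e / (8 * k)"
      using order_tendstoD(2)[OF lim[OF gc] small] .
    moreover have "\<forall>\<^sub>F n in sequentially. integ (Ms n) (\<lambda>x. pw x p) < B"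
      using order_tendstoD(2)[OF lim[OF gp]] by (simp add: B_def)
    moreover have "\<forall>\<^sub>F n in sequentially. \<forall>i\<in>{..<m}. (1 - \<eta>) * integ M (\<psi> i) < integ (Ms n) (\<psi> i)
         \<and> (1 - \<eta>) * integ (Ms n) (\<psi> i) < integ M (\<psi> i)"
    proof (intro eventually_ball_finite finite_lessThan ballI eventually_conj)
      fix i assume "i \<in> {..<m}"
      then have i: "i < m" by simp
      \<comment> \<open>Strict because every \<open>\<psi> i\<close> has positive integral;
        convergence of the weights therefore yields closeness of their ratios, the form in which the
        coupling needs it.\<close>
      have lt: "(1 - \<eta>) * integ M (\<psi> i) < integ M (\<psi> i)"
        using quantizer_weights(4)[OF q M i] eta by simp
      note li = lim[OF quantizer_pgrowth[OF q i]]
      show "\<forall>\<^sub>F n in sequentially. (1 - \<eta>) * integ M (\<psi> i) < integ (Ms n) (\<psi> i)"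
        using order_tendstoD(1)[OF li lt] .
      show "\<forall>\<^sub>F n in sequentially. (1 - \<eta>) * integ (Ms n) (\<psi> i) < integ M (\<psi> i)"
        using order_tendstoD(2)[OF tendsto_mult_left[OF li] lt] .
    qed
    ultimately have "\<forall>\<^sub>F n in sequentially. norm (enn2real (INF \<pi>\<in>couplings (Ms n) M. cost p \<pi>) - 0) < e"
    proof eventually_elim
      case (elim n)
      define X where "X = k * (integ (Ms n) ?c + integ M ?c)
          + 2 * \<eta> * k * (integ (Ms n) (\<lambda>x. pw x p) + integ M (\<lambda>x. pw x p))"
      have "(INF \<pi>\<in>couplings (Ms n) M. cost p \<pi>) \<le> ennreal X"
        unfolding X_def k_def
        by (rule Inf_cost_le[OF p Ms M q eta(1,2)]) (use elim(3) in \<open>auto intro: less_imp_le\<close>)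
      have nn: "0 \<le> integ L ?c" for L using quantizerD(6)[OF q]
        by (intro Bochner_Integration.integral_nonneg sum_nonneg mult_nonneg_nonneg) (auto intro: less_imp_le)
      have "0 \<le> X" unfolding X_def using k eta
        by (intro add_nonneg_nonneg mult_nonneg_nonneg nn) auto
      have "X \<le> k * (e / (8 * k) + e / (8 * k)) + 2 * (e / (16 * k * B)) * k * (B + B)"
        unfolding X_def
      proof (intro add_mono mult_mono)
        show "integ M (\<lambda>x. pw x p) \<le> B" by (simp add: B_def)
      qed (use elim small eta k B e nn in \<open>auto intro!: less_imp_le add_nonneg_nonneg Bochner_Integration.integral_nonneg\<close>)
      also have "\<dots> = e / 2" using k B by (simp add: field_simps)
      finally have "X < e" using e by simp
      moreover have "enn2real (INF \<pi>\<in>couplings (Ms n) M. cost p \<pi>) \<le> X"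
        using \<open>0 \<le> X\<close> \<open>_ \<le> ennreal X\<close> by (rule enn2real_leI)
      ultimately show ?case by simp
    qed
    then show "\<exists>no. \<forall>n\<ge>no. norm (enn2real (INF \<pi>\<in>couplings (Ms n) M. cost p \<pi>) - 0) < e"
      unfolding eventually_sequentially .
  qed
  then show ?thesis
    unfolding wasserstein_def using p
    by (intro tendsto_zero_powrI[where b = "1 / p"]) auto
qed

lemma Pconv_iff_pweak:
  fixes M :: "'a::euclidean_space measure"
  assumes p: "p = 0 \<or> p \<ge> 1"
  shows "Pconv p Ms M \<longleftrightarrow> (\<forall>n. Ms n \<in> Pp p) \<and> M \<in> Pp p \<and> pweak p Ms M"
proof (cases "p = 0")
  case True
  have "bcont \<phi> \<longleftrightarrow> pgrowth p \<phi>" for \<phi> :: "'a \<Rightarrow> real"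
  proof
    assume "bcont \<phi>"
    then obtain B where "\<And>x. \<bar>\<phi> x\<bar> \<le> B" "continuous_on UNIV \<phi>"
      unfolding bcont_def bounded_iff by auto
    then show "pgrowth p \<phi>" by (intro pgrowth_bounded)
  next
    assume "pgrowth p \<phi>"
    then obtain C where "\<And>x. \<bar>\<phi> x\<bar> \<le> C * 2" "continuous_on UNIV \<phi>"
      unfolding pgrowth_def True by (auto simp: pw_def)
    then show "bcont \<phi>" unfolding bcont_def bounded_iff by auto
  qed
  then show ?thesis using True by (simp add: Pconv_def weak_conv_def pweak_def)
next
  case False
  then have "p \<ge> 1" using p by simp
  then show ?thesis
    unfolding Pconv_def using wasserstein_tendsto_if_pweak pweak_if_wasserstein_tendsto False by metis
qed

section \<open>Continuity and differentiability along measures\<close>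

lemma pweak_const: "pweak p (\<lambda>_. M) M"
  by (simp add: pweak_def)

lemma pweak_subseq:
  assumes "pweak p Ms M" "filterlim r at_top sequentially"
  shows "pweak p (\<lambda>n. Ms (r n)) M"
  using assms unfolding pweak_def by (auto intro: filterlim_compose)

lemma filterlim_at_top_ge_id:
  assumes "\<And>k::nat. k \<le> r k" shows "filterlim r at_top sequentially"
  by (rule filterlim_at_top_mono[OF filterlim_ident]) (use assms in auto)

text \<open>The second hypothesis is uniform convergence on the unit interval in sequential form,
  arbitrary parameters along arbitrary index sequences tending to infinity. This is the form in
  which continuity of \<open>D\<close> can be applied.\<close>

lemma interval_integral_tendsto:
  fixes E :: "nat \<Rightarrow> real \<Rightarrow> real"
  assumes cont: "\<And>n. continuous_on {0..1} (E n)"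
    and lim: "\<And>r t. filterlim r at_top sequentially \<Longrightarrow> (\<And>n. t n \<in> {0..1}) \<Longrightarrow> (\<lambda>n. E (r n) (t n)) \<longlonglongrightarrow> l"
  shows "(\<lambda>n. LBINT t=0..1. E n t) \<longlonglongrightarrow> l"
proof (rule LIMSEQ_I)
  fix e :: real assume e: "0 < e"
  have "\<exists>n0. \<forall>n\<ge>n0. \<forall>t\<in>{0..1}. \<bar>E n t - l\<bar> < e / 2"
  proof (rule ccontr)
    assume "\<not> ?thesis"
    then have "\<forall>k. \<exists>n\<ge>k. \<exists>t\<in>{0..1}. \<not> \<bar>E n t - l\<bar> < e / 2" by blast
    then obtain r t where rt: "\<And>k. k \<le> r k" "\<And>k. t k \<in> {0..1}" "\<And>k. \<not> \<bar>E (r k) (t k) - l\<bar> < e / 2"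
      by metis
    have "(\<lambda>n. E (r n) (t n)) \<longlonglongrightarrow> l"
      using lim[OF filterlim_at_top_ge_id[OF rt(1)] rt(2)] .
    from LIMSEQ_D[OF this, of "e / 2"] e rt(3) show False by auto
  qed
  then obtain n0 where n0: "\<forall>n\<ge>n0. \<forall>t\<in>{0..1}. \<bar>E n t - l\<bar> < e / 2" by blast
  have "norm ((LBINT t=0..1. E n t) - l) < e" if n: "n \<ge> n0" for n
  proof -
    have int: "set_integrable lborel {0..1} (E n)"
      by (rule borel_integrable_atLeastAtMost') (rule cont)
    have intc: "set_integrable lborel {0..1::real} (\<lambda>_. c :: real)" for c
      by (rule borel_integrable_atLeastAtMost') simp
    have c: "(LBINT t:{0..1::real}. (c::real)) = c" for c
      by (simp add: set_lebesgue_integral_def content_real)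
    have bd: "E n t \<le> l + e / 2" "l - e / 2 \<le> E n t" if "t \<in> {0..1}" for t
      using n0[rule_format, OF n that] unfolding abs_less_iff by linarith+
    have "(LBINT t=0..1. E n t) = (LBINT t:{0..1}. E n t)"
      using interval_integral_Icc[of 0 1 "E n"] by (simp add: zero_ereal_def one_ereal_def)
    moreover have "(LBINT t:{0..1}. E n t) \<le> (LBINT t:{0..1::real}. l + e / 2)"
      by (intro set_integral_mono int intc bd)
    moreover have "(LBINT t:{0..1::real}. l - e / 2) \<le> (LBINT t:{0..1}. E n t)"
      by (intro set_integral_mono int intc bd)
    ultimately show ?thesis unfolding c using e by (simp add: abs_less_iff)
  qed
  then show "\<exists>no. \<forall>n\<ge>no. norm ((LBINT t=0..1. E n t) - l) < e" by blast
qed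

text \<open>A sequence in this set either takes some value infinitely often, which gives a constant
  subsequence, or takes each value finitely often and then converges to \<open>M\<close> itself.
  Through this lemma the growth bound on compact sets becomes available along convergent
  sequences.\<close>

lemma Pcompact_convergent_sequence:
  fixes M :: "'a::euclidean_space measure"
  assumes p: "p = 0 \<or> p \<ge> 1" and Ms: "\<And>n. Ms n \<in> Pp p" and M: "M \<in> Pp p" and w: "pweak p Ms M"
  shows "Pcompact p (insert M (range Ms))"
  unfolding Pcompact_def
proof (intro conjI allI impI)
  show "insert M (range Ms) \<subseteq> Pp p" using Ms M by auto
  fix As :: "nat \<Rightarrow> 'a measure" assume As: "\<forall>n. As n \<in> insert M (range Ms)"
  then have AsP: "As n \<in> Pp p" for n using Ms M by (metis insertE rangeE)
  show "\<exists>r L. strict_mono r \<and> L \<in> insert M (range Ms) \<and> Pconv p (As \<circ> r) L"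
  proof (cases "\<exists>B. infinite {j. As j = B}")
    case True
    then obtain B where B: "infinite {j. As j = B}" by blast
    define r where "r = enumerate {j. As j = B}"
    have r: "strict_mono r" "\<And>n. As (r n) = B"
      using strict_mono_enumerate[OF B] enumerate_in_set[OF B] by (auto simp: r_def)
    have "Pconv p (As \<circ> r) B"
      unfolding Pconv_iff_pweak[OF p] using r AsP by (auto simp: o_def pweak_const) (metis r(2) AsP)
    then show ?thesis using r As by metis
  next
    case False
    have "pweak p As M"
      unfolding pweak_def
    proof (intro allI impI LIMSEQ_I)
      fix \<phi> :: "'a \<Rightarrow> real" and e :: real assume g: "pgrowth p \<phi>" and e: "0 < e"
      then have "(\<lambda>n. integ (Ms n) \<phi>) \<longlonglongrightarrow> integ M \<phi>" using w unfolding pweak_def by blast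
      from LIMSEQ_D[OF this e] obtain n0 where n0: "\<forall>n\<ge>n0. norm (integ (Ms n) \<phi> - integ M \<phi>) < e" by blast
      have "finite (\<Union>n<n0. {j. As j = Ms n})" using False by auto
      then obtain j0 where j0: "\<forall>j\<in>(\<Union>n<n0. {j. As j = Ms n}). j < j0"
        unfolding finite_nat_set_iff_bounded by (rule exE)
      have "norm (integ (As j) \<phi> - integ M \<phi>) < e" if "j \<ge> j0" for j
      proof -
        have "\<And>n. As j = Ms n \<Longrightarrow> n \<ge> n0" using j0 that by (fastforce simp: not_le[symmetric])
        then show ?thesis using As n0 e by (metis diff_self insertE norm_zero rangeE)
      qed
      then show "\<exists>j0. \<forall>j\<ge>j0. norm (integ (As j) \<phi> - integ M \<phi>) < e" by blast
    qed
    then have "Pconv p (As \<circ> id) M" unfolding Pconv_iff_pweak[OF p] using AsP M by simp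
    then show ?thesis by (intro exI[of _ id] exI[of _ M]) (auto simp: strict_mono_def)
  qed
qed

locale C1_function =
  fixes p :: real and f :: "'a::euclidean_space measure \<Rightarrow> real" and D :: "'a \<Rightarrow> 'a measure \<Rightarrow> real"
  assumes p: "p = 0 \<or> p \<ge> 1" and C1: "C1_version p f D"
begin

lemma D_tendsto:
  assumes "\<And>n. Ms n \<in> Pp p" "M \<in> Pp p" "pweak p Ms M" "xs \<longlonglongrightarrow> x"
  shows "(\<lambda>n. D (xs n) (Ms n)) \<longlonglongrightarrow> D x M"
proof -
  have "Pconv p Ms M" unfolding Pconv_iff_pweak[OF p] using assms by blast
  then show ?thesis using C1 assms(4) unfolding C1_version_def by blast
qed

text \<open>Joint sequential continuity in the shape required by
  \<open>pweak_integral_cconv\<close>. If it failed, violating points at distance below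
  \<open>1 / (k + 1)\<close> and violating indices at least \<open>k\<close> would give sequences
  contradicting \<open>D_tendsto\<close>.\<close>

lemma D_cconv:
  assumes Ms: "\<And>n. Ms n \<in> Pp p" and M: "M \<in> Pp p" and w: "pweak p Ms M"
  shows "cconv (\<lambda>n x. D x (Ms n)) (\<lambda>x. D x M)"
  unfolding cconv_def
proof (intro allI impI)
  fix x :: 'a and \<eta> :: real assume eta: "0 < \<eta>"
  show "\<exists>\<delta>>0. \<exists>n0. \<forall>n\<ge>n0. \<forall>y. dist y x < \<delta> \<longrightarrow> \<bar>D y (Ms n) - D x M\<bar> < \<eta>"
  proof (rule ccontr)
    assume "\<not> ?thesis"
    then have *: "\<exists>n\<ge>n0. \<exists>y. dist y x < \<delta> \<and> \<not> \<bar>D y (Ms n) - D x M\<bar> < \<eta>" if "\<delta> > 0" for \<delta> n0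
      using that by blast
    have "\<exists>n\<ge>k. \<exists>y. dist y x < inverse (real (Suc k)) \<and> \<not> \<bar>D y (Ms n) - D x M\<bar> < \<eta>" for k
      by (rule *) simp
    then obtain r y where ry: "\<And>k. k \<le> r k" "\<And>k. dist (y k) x < inverse (real (Suc k))"
        "\<And>k. \<not> \<bar>D (y k) (Ms (r k)) - D x M\<bar> < \<eta>"
      by metis
    have "(\<lambda>k. dist (y k) x) \<longlonglongrightarrow> 0"
      by (rule tendsto_sandwich[OF _ _ tendsto_const LIMSEQ_inverse_real_of_nat])
         (use ry(2) in \<open>auto intro!: always_eventually less_imp_le\<close>)
    then have "y \<longlonglongrightarrow> x" by (rule tendsto_dist_iff[THEN iffD2])
    with Ms M pweak_subseq[OF w filterlim_at_top_ge_id[OF ry(1)]]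
    have "(\<lambda>k. D (y k) (Ms (r k))) \<longlonglongrightarrow> D x M" by (intro D_tendsto) auto
    from LIMSEQ_D[OF this eta] ry(3) show False by auto
  qed
qed

lemma D_bound_sequence:
  assumes "\<And>n. Ms n \<in> Pp p" "M \<in> Pp p" "pweak p Ms M"
  shows "\<exists>C. \<forall>n x. \<bar>D x (Ms n)\<bar> \<le> C * (1 + pw x p)"
proof -
  have "\<forall>K. Pcompact p K \<longrightarrow> (\<exists>c. \<forall>x. \<forall>M\<in>K. \<bar>D x M\<bar> \<le> c * (1 + pw x p))"
    using C1 unfolding C1_version_def by blast
  from this[rule_format, OF Pcompact_convergent_sequence[OF p assms]] show ?thesis by blast
qed

lemma D_pgrowth: "M \<in> Pp p \<Longrightarrow> pgrowth p (\<lambda>x. D x M)"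
  using D_bound_sequence[of "\<lambda>_. M" M] cconv_continuous[OF D_cconv[of "\<lambda>_. M" M]]
  by (auto simp: pgrowth_def pweak_const)

lemma integral_D_tendsto:
  assumes Ns: "\<And>n. Ns n \<in> Pp p" "N \<in> Pp p" "pweak p Ns N"
    and Ms: "\<And>n. Ms n \<in> Pp p" "M \<in> Pp p" "pweak p Ms M"
  shows "(\<lambda>n. integ (Ns n) (\<lambda>x. D x (Ms n))) \<longlonglongrightarrow> integ N (\<lambda>x. D x M)"
proof -
  obtain C where "\<And>n x. \<bar>D x (Ms n)\<bar> \<le> C * (1 + pw x p)" using D_bound_sequence[OF Ms] by blast
  then show ?thesis
    by (intro pweak_integral_cconv[OF p Ns D_cconv[OF Ms]] pgrowth_measurable[OF D_pgrowth] Ms)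
qed

lemma f_increment:
  "M \<in> Pp p \<Longrightarrow> N \<in> Pp p \<Longrightarrow>
    f N - f M = (LBINT t=0..1. integ N (\<lambda>x. D x (mix t N M)) - integ M (\<lambda>x. D x (mix t N M)))"
  using C1 unfolding C1_version_def by blast

lemma continuous_on_D_mix:
  assumes "M \<in> Pp p" "N \<in> Pp p"
  shows "continuous_on {0..1} (\<lambda>t. D x (mix t N M))"
    "L \<in> Pp p \<Longrightarrow> continuous_on {0..1} (\<lambda>t. integ L (\<lambda>x. D x (mix t N M)))"
  unfolding continuous_on_sequentially
  using assms
  by (auto simp: o_def intro!: D_tendsto integral_D_tendsto pweak_mix_weight[OF p] mix_Pp[OF _ _ _ _ p] pweak_const)

text \<open>Continuity of \<open>f\<close> is a consequence of the increment formula: the mixtures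
  of \<open>Ns n\<close> with \<open>M\<close> tend to \<open>M\<close> whatever their parameters,
  so the two inner integrals have the same limit.\<close>

lemma f_tendsto:
  assumes Ns: "\<And>n. Ns n \<in> Pp p" and M: "M \<in> Pp p" and w: "pweak p Ns M"
  shows "(\<lambda>n. f (Ns n)) \<longlonglongrightarrow> f M"
proof -
  have "(\<lambda>n. LBINT t=0..1. integ (Ns n) (\<lambda>x. D x (mix t (Ns n) M)) - integ M (\<lambda>x. D x (mix t (Ns n) M))) \<longlonglongrightarrow> 0"
  proof (rule interval_integral_tendsto)
    show "continuous_on {0..1} (\<lambda>t. integ (Ns n) (\<lambda>x. D x (mix t (Ns n) M)) - integ M (\<lambda>x. D x (mix t (Ns n) M)))" for n
      by (intro continuous_intros continuous_on_D_mix Ns M)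
    fix r :: "nat \<Rightarrow> nat" and t :: "nat \<Rightarrow> real"
    assume r: "filterlim r at_top sequentially" and t: "\<And>n. t n \<in> {0..1}"
    note wr = pweak_subseq[OF w r]
    have m: "mix (t n) (Ns (r n)) M \<in> Pp p" for n using t[of n] by (intro mix_Pp[OF _ _ _ _ p] Ns M) auto
    have wm: "pweak p (\<lambda>n. mix (t n) (Ns (r n)) M) M"
      using t by (intro pweak_mix[OF p Ns M wr]) auto
    have "(\<lambda>n. integ (Ns (r n)) (\<lambda>x. D x (mix (t n) (Ns (r n)) M)) - integ M (\<lambda>x. D x (mix (t n) (Ns (r n)) M)))
       \<longlonglongrightarrow> integ M (\<lambda>x. D x M) - integ M (\<lambda>x. D x M)"
      by (intro tendsto_diff integral_D_tendsto m wm M Ns wr pweak_const)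
    then show "(\<lambda>n. integ (Ns (r n)) (\<lambda>x. D x (mix (t n) (Ns (r n)) M)) - integ M (\<lambda>x. D x (mix (t n) (Ns (r n)) M))) \<longlonglongrightarrow> 0"
      by simp
  qed
  then have "(\<lambda>n. f (Ns n) - f M) \<longlonglongrightarrow> 0" using f_increment[OF M Ns] by simp
  then show ?thesis by (simp add: LIM_zero_iff)
qed

text \<open>The hypothesis on \<open>s\<close> says that \<open>Ns n\<close> minus \<open>M\<close>
  is \<open>s n\<close> times the point mass at \<open>x\<close> minus \<open>M\<close>. Pulling
  \<open>s n\<close> out of the increment formula leaves a centred derivative; this is where the
  undetermined additive constant shows up.\<close>

lemma f_increment_towards_point:
  assumes Ns: "\<And>n. Ns n \<in> Pp p" and M: "M \<in> Pp p" and w: "pweak p Ns M"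
    and s: "\<And>n \<phi>. pgrowth p \<phi> \<Longrightarrow> integ (Ns n) \<phi> - integ M \<phi> = s n * (\<phi> x - integ M \<phi>)"
  shows "\<exists>J. (\<forall>n. f (Ns n) - f M = s n * J n) \<and> J \<longlonglongrightarrow> D x M - integ M (\<lambda>z. D z M)"
proof (intro exI conjI allI)
  let ?e = "\<lambda>n t. D x (mix t (Ns n) M) - integ M (\<lambda>x. D x (mix t (Ns n) M))"
  show "f (Ns n) - f M = s n * (LBINT t=0..1. ?e n t)" for n
  proof -
    have "(LBINT t=0..1. integ (Ns n) (\<lambda>x. D x (mix t (Ns n) M)) - integ M (\<lambda>x. D x (mix t (Ns n) M)))
      = (LBINT t=0..1. s n * ?e n t)"
    proof (rule interval_integral_cong)
      fix t assume "t \<in> einterval (min 0 1) (max 0 1)"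
      then have "0 \<le> t" "t \<le> 1" by (auto simp: einterval_def zero_ereal_def one_ereal_def min_def max_def)
      then have "pgrowth p (\<lambda>x. D x (mix t (Ns n) M))" by (intro D_pgrowth mix_Pp[OF _ _ _ _ p] Ns M)
      from s[OF this] show "integ (Ns n) (\<lambda>x. D x (mix t (Ns n) M)) - integ M (\<lambda>x. D x (mix t (Ns n) M)) = s n * ?e n t" .
    qed
    then show ?thesis using f_increment[OF M Ns] by simp
  qed
  show "(\<lambda>n. LBINT t=0..1. ?e n t) \<longlonglongrightarrow> D x M - integ M (\<lambda>z. D z M)"
  proof (rule interval_integral_tendsto)
    show "continuous_on {0..1} (?e n)" for n
      by (intro continuous_intros continuous_on_D_mix Ns M)
    fix r :: "nat \<Rightarrow> nat" and t :: "nat \<Rightarrow> real"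
    assume r: "filterlim r at_top sequentially" and t: "\<And>n. t n \<in> {0..1}"
    have m: "mix (t n) (Ns (r n)) M \<in> Pp p" for n using t[of n] by (intro mix_Pp[OF _ _ _ _ p] Ns M) auto
    have wm: "pweak p (\<lambda>n. mix (t n) (Ns (r n)) M) M"
      using t by (intro pweak_mix[OF p Ns M pweak_subseq[OF w r]]) auto
    show "(\<lambda>n. ?e (r n) (t n)) \<longlonglongrightarrow> D x M - integ M (\<lambda>z. D z M)"
      by (intro tendsto_diff integral_D_tendsto D_tendsto m wm M pweak_const tendsto_const)
  qed
qed

end

text \<open>Quantization is moved to the test function, whose averages converge continuously with
  uniform growth. The measures vary with the level because the compactness argument below needs
  it.\<close>

lemma pweak_quant_infinity:
  fixes M :: "'a::euclidean_space measure"
  assumes p: "p = 0 \<or> p \<ge> 1" and q: "\<And>n. quantizer p (R n) (m n) (xs n) (\<psi> n) (\<epsilon> n)"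
    and R: "filterlim R at_top sequentially"
    and Ms: "\<And>n. Ms n \<in> Pp p" and M: "M \<in> Pp p" and w: "pweak p Ms M"
  shows "pweak p (\<lambda>n. quant (m n) (xs n) (\<psi> n) (Ms n)) M"
  unfolding pweak_def
proof (intro allI impI)
  fix \<phi> :: "'a \<Rightarrow> real" assume g: "pgrowth p \<phi>"
  then obtain C where C: "\<And>x. \<bar>\<phi> x\<bar> \<le> C * (1 + pw x p)" and cont: "continuous_on UNIV \<phi>"
    unfolding pgrowth_def by blast
  have "(\<lambda>n. integ (Ms n) (qavg (m n) (xs n) (\<psi> n) \<phi>)) \<longlonglongrightarrow> integ M \<phi>"
    by (rule pweak_integral_cconv[OF p Ms M w qavg_cconv[OF p q R cconv_const[OF cont] C]
          pgrowth_measurable[OF qavg_pgrowth[OF q]] qavg_growth[OF p q C]])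
  then show "(\<lambda>n. integ (quant (m n) (xs n) (\<psi> n) (Ms n)) \<phi>) \<longlonglongrightarrow> integ M \<phi>"
    using integral_quant[OF q Ms pgrowth_measurable[OF g]] by simp
qed

lemma pweak_quant:
  assumes q: "quantizer p R m xs \<psi> \<epsilon>"
    and Ms: "\<And>n. Ms n \<in> Pp p" and M: "M \<in> Pp p" and w: "pweak p Ms M"
  shows "pweak p (\<lambda>n. quant m xs \<psi> (Ms n)) (quant m xs \<psi> M)"
  unfolding pweak_def
proof (intro allI impI)
  fix \<phi> :: "'a \<Rightarrow> real" assume g: "pgrowth p \<phi>"
  have "(\<lambda>n. integ (Ms n) (qavg m xs \<psi> \<phi>)) \<longlonglongrightarrow> integ M (qavg m xs \<psi> \<phi>)"
    using w qavg_pgrowth[OF q] unfolding pweak_def by blast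
  then show "(\<lambda>n. integ (quant m xs \<psi> (Ms n)) \<phi>) \<longlonglongrightarrow> integ (quant m xs \<psi> M) \<phi>"
    using integral_quant[OF q _ pgrowth_measurable[OF g]] Ms M by simp
qed

section \<open>Compactness of the quantizations of all levels\<close>

lemma nat_sequence_cases:
  fixes j :: "nat \<Rightarrow> nat"
  obtains (const) k r where "strict_mono r" "\<And>n::nat. j (r n) = k" | (infinity) "filterlim j at_top sequentially"
proof (cases "\<exists>k. infinite {n. j n = k}")
  case True
  then obtain k where k: "infinite {n. j n = k}" by blast
  show thesis
    by (rule const[OF strict_mono_enumerate[OF k], of k]) (use enumerate_in_set[OF k] in auto)
next
  case False
  have "\<forall>\<^sub>F n in sequentially. B \<le> j n" for B
  proof -
    have "finite (\<Union>k<B. {n. j n = k})" using False by auto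
    then obtain n0 where n0: "\<forall>n\<in>(\<Union>k<B. {n. j n = k}). n < n0"
      unfolding finite_nat_set_iff_bounded by (rule exE)
    have "B \<le> j n" if "n \<ge> n0" for n
      using n0 that by (fastforce simp: not_le[symmetric])
    then show ?thesis unfolding eventually_sequentially by blast
  qed
  then show thesis by (intro infinity) (simp add: filterlim_at_top)
qed

text \<open>Measures and levels are arbitrary sequences. After passing to a convergent subsequence
  of measures, a repeated level gives the quantization of the limit by \<open>pweak_quant\<close>,
  while levels tending to infinity give the limit itself.\<close>

lemma quant_convergent_subsequence:
  fixes K :: "'a::euclidean_space measure set" and Ms :: "nat \<Rightarrow> 'a measure" and \<kappa> :: "nat \<Rightarrow> nat"
  assumes p: "p = 0 \<or> p \<ge> 1" and q: "\<And>k. quantizer p (real (Suc k)) (m k) (xs k) (\<psi> k) (\<epsilon> k)"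
    and K: "Pcompact p K" and Ms: "\<And>n. Ms n \<in> K"
  shows "\<exists>r L. strict_mono r \<and> L \<in> Pp p \<and>
    pweak p (\<lambda>n. quant (m (\<kappa> (r n))) (xs (\<kappa> (r n))) (\<psi> (\<kappa> (r n))) (Ms (r n))) L"
proof -
  have "\<forall>Ms. (\<forall>n. Ms n \<in> K) \<longrightarrow> (\<exists>(r::nat \<Rightarrow> nat) M. strict_mono r \<and> M \<in> K \<and> Pconv p (Ms \<circ> r) M)"
    using K unfolding Pcompact_def by (rule conjunct2)
  then obtain r :: "nat \<Rightarrow> nat" and M where r: "strict_mono r" and c: "Pconv p (Ms \<circ> r) M"
    using Ms by blast
  have w: "pweak p (\<lambda>n. Ms (r n)) M" and M: "M \<in> Pp p" and MP: "\<And>n. Ms (r n) \<in> Pp p"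
    using c unfolding Pconv_iff_pweak[OF p] by (auto simp: o_def)
  show ?thesis
  proof (cases rule: nat_sequence_cases[of "\<lambda>n. \<kappa> (r n)"])
    case (const k s)
    have "pweak p (\<lambda>n. quant (m k) (xs k) (\<psi> k) (Ms (r (s n)))) (quant (m k) (xs k) (\<psi> k) M)"
      by (intro pweak_quant[OF q] MP M pweak_subseq[OF w filterlim_subseq[OF const(1)]])
    then show ?thesis using const strict_mono_o[OF r const(1)] quant_Pp[OF p q M]
      by (intro exI[of _ "r \<circ> s"] exI[of _ "quant (m k) (xs k) (\<psi> k) M"]) (auto simp: o_def)
  next
    case infinity
    have "filterlim (\<lambda>n. real (Suc (\<kappa> (r n)))) at_top sequentially"
      by (rule filterlim_compose[OF filterlim_compose[OF filterlim_real_sequentially filterlim_Suc] infinity])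
    then have "pweak p (\<lambda>n. quant (m (\<kappa> (r n))) (xs (\<kappa> (r n))) (\<psi> (\<kappa> (r n))) (Ms (r n))) M"
      by (rule pweak_quant_infinity[OF p q _ MP M w])
    then show ?thesis using r M by blast
  qed
qed

context C1_function begin

context
  fixes m :: "nat \<Rightarrow> nat" and xs :: "nat \<Rightarrow> nat \<Rightarrow> 'a" and \<psi> :: "nat \<Rightarrow> nat \<Rightarrow> 'a \<Rightarrow> real" and \<epsilon> :: "nat \<Rightarrow> real"
  assumes q: "\<And>k. quantizer p (real (Suc k)) (m k) (xs k) (\<psi> k) (\<epsilon> k)"
begin

text \<open>The constant must serve all levels at once. A violating sequence has a subsequence along
  which the quantizations converge, and there \<open>f\<close> converges and is bounded. The bound
  for \<open>D\<close> below follows the same pattern.\<close>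

lemma quant_f_bounded:
  assumes K: "Pcompact p K"
  shows "\<exists>c. \<forall>M\<in>K. \<forall>k. \<bar>f (quant (m k) (xs k) (\<psi> k) M)\<bar> \<le> c"
proof (rule ccontr)
  assume "\<not> ?thesis"
  then have "\<forall>n::nat. \<exists>M k. M \<in> K \<and> real n < \<bar>f (quant (m k) (xs k) (\<psi> k) M)\<bar>"
    by (meson not_le)
  then obtain Ms \<kappa> where Ms: "\<And>n. Ms n \<in> K"
      and bad: "\<And>n. real n < \<bar>f (quant (m (\<kappa> n)) (xs (\<kappa> n)) (\<psi> (\<kappa> n)) (Ms n))\<bar>"
    by metis
  obtain r L where r: "strict_mono r" and L: "L \<in> Pp p"
      and w: "pweak p (\<lambda>n. quant (m (\<kappa> (r n))) (xs (\<kappa> (r n))) (\<psi> (\<kappa> (r n))) (Ms (r n))) L"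
    using quant_convergent_subsequence[where xs = xs and Ms = Ms and \<kappa> = \<kappa>, OF p q K Ms] by blast
  have MP: "Ms n \<in> Pp p" for n using Ms K unfolding Pcompact_def by blast
  have "(\<lambda>n. f (quant (m (\<kappa> (r n))) (xs (\<kappa> (r n))) (\<psi> (\<kappa> (r n))) (Ms (r n)))) \<longlonglongrightarrow> f L"
    by (intro f_tendsto quant_Pp[OF p q] MP L w)
  then have "Bseq (\<lambda>n. f (quant (m (\<kappa> (r n))) (xs (\<kappa> (r n))) (\<psi> (\<kappa> (r n))) (Ms (r n))))"
    by (rule convergent_imp_Bseq[OF convergentI])
  then obtain B where B: "\<And>n. \<bar>f (quant (m (\<kappa> (r n))) (xs (\<kappa> (r n))) (\<psi> (\<kappa> (r n))) (Ms (r n)))\<bar> \<le> B"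
    unfolding Bseq_def by auto
  obtain n where n: "B \<le> real n" using real_arch_simple by blast
  have "real n \<le> real (r n)" using seq_suble[OF r, of n] by simp
  then show False using B[of n] bad[of "r n"] n by linarith
qed

lemma quant_D_bounded:
  assumes K: "Pcompact p K"
  shows "\<exists>c. \<forall>M\<in>K. \<forall>k x. \<bar>D x (quant (m k) (xs k) (\<psi> k) M)\<bar> \<le> c * (1 + pw x p)"
proof (rule ccontr)
  assume "\<not> ?thesis"
  then have "\<forall>n::nat. \<exists>M k x. M \<in> K \<and> real n * (1 + pw x p) < \<bar>D x (quant (m k) (xs k) (\<psi> k) M)\<bar>"
    by (meson not_le)
  then obtain Ms \<kappa> x where Ms: "\<And>n. Ms n \<in> K"
      and bad: "\<And>n. real n * (1 + pw (x n) p) < \<bar>D (x n) (quant (m (\<kappa> n)) (xs (\<kappa> n)) (\<psi> (\<kappa> n)) (Ms n))\<bar>"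
    by metis
  obtain r L where r: "strict_mono r" and L: "L \<in> Pp p"
      and w: "pweak p (\<lambda>n. quant (m (\<kappa> (r n))) (xs (\<kappa> (r n))) (\<psi> (\<kappa> (r n))) (Ms (r n))) L"
    using quant_convergent_subsequence[where xs = xs and Ms = Ms and \<kappa> = \<kappa>, OF p q K Ms] by blast
  have MP: "Ms n \<in> Pp p" for n using Ms K unfolding Pcompact_def by blast
  obtain C where C: "\<And>n x. \<bar>D x (quant (m (\<kappa> (r n))) (xs (\<kappa> (r n))) (\<psi> (\<kappa> (r n))) (Ms (r n)))\<bar> \<le> C * (1 + pw x p)"
    using D_bound_sequence[OF quant_Pp[OF p q MP] L w] by blast
  obtain n where n: "C \<le> real n" using real_arch_simple by blast
  have "real n \<le> real (r n)" using seq_suble[OF r, of n] by simp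
  then have "C * (1 + pw (x (r n)) p) \<le> real (r n) * (1 + pw (x (r n)) p)"
    using n by (intro mult_right_mono) (auto simp: less_imp_le)
  then show False using C[of "x (r n)" n] bad[of "r n"] by linarith
qed

lemma quant_f_tendsto:
  assumes M: "M \<in> Pp p"
  shows "(\<lambda>k. f (quant (m k) (xs k) (\<psi> k) M)) \<longlonglongrightarrow> f M"
  by (intro f_tendsto quant_Pp[OF p q] M pweak_quant_infinity[OF p q] pweak_const
        filterlim_compose[OF filterlim_real_sequentially filterlim_Suc])

lemma quant_D_tendsto:
  assumes M: "M \<in> Pp p"
  shows "(\<lambda>k. qavg (m k) (xs k) (\<psi> k) (\<lambda>z. D z (quant (m k) (xs k) (\<psi> k) M)) x) \<longlonglongrightarrow> D x M"
proof -
  have R: "filterlim (\<lambda>k. real (Suc k)) at_top sequentially"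
    by (rule filterlim_compose[OF filterlim_real_sequentially filterlim_Suc])
  have w: "pweak p (\<lambda>k. quant (m k) (xs k) (\<psi> k) M) M"
    by (intro M pweak_quant_infinity[OF p q R] pweak_const)
  obtain C where C: "\<And>k x. \<bar>D x (quant (m k) (xs k) (\<psi> k) M)\<bar> \<le> C * (1 + pw x p)"
    using D_bound_sequence[OF quant_Pp[OF p q M] M w] by blast
  show ?thesis
    by (rule cconv_pointwise[OF qavg_cconv[OF p q R D_cconv[OF quant_Pp[OF p q M] M w] C]])
qed

end

end

section \<open>Cylinder functions\<close>

lemma DERIV_min_zero_square: "((\<lambda>s::real. (min s 0)\<^sup>2) has_real_derivative 2 * min s 0) (at s)"
proof -
  consider "s < 0" | "s > 0" | "s = 0" by linarith
  then show ?thesis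
  proof cases
    case 1
    have "((\<lambda>s::real. s\<^sup>2) has_real_derivative 2 * min s 0) (at s)"
      using 1 by (auto intro!: derivative_eq_intros)
    then show ?thesis
      by (rule has_field_derivative_transform_within_open[of _ _ _ "{..<0}"]) (use 1 in auto)
  next
    case 2
    have "((\<lambda>s::real. 0) has_real_derivative 2 * min s 0) (at s)"
      using 2 by (auto intro!: derivative_eq_intros)
    then show ?thesis
      by (rule has_field_derivative_transform_within_open[of _ _ _ "{0<..}"]) (use 2 in auto)
  next
    case 3
    have "((\<lambda>h::real. (min h 0)\<^sup>2 / h) \<longlongrightarrow> 0) (at 0)"
    proof (rule Lim_null_comparison)
      show "\<forall>\<^sub>F h::real in at 0. norm ((min h 0)\<^sup>2 / h) \<le> \<bar>h\<bar>"
        by (intro always_eventually allI) (auto simp: min_def power2_eq_square)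
      show "((\<lambda>h::real. \<bar>h\<bar>) \<longlongrightarrow> 0) (at 0)" by (intro tendsto_rabs_zero tendsto_ident_at)
    qed
    then show ?thesis using 3 by (simp add: DERIV_def)
  qed
qed

text \<open>A positive C^1 function on the reals that is the identity on \<open>{e..}\<close>.\<close>

definition positive_extension :: "real \<Rightarrow> real \<Rightarrow> real" where
  "positive_extension e s = s + (min (s - e) 0)\<^sup>2 / (2 * e)"

lemma positive_extension_pos: "0 < e \<Longrightarrow> 0 < positive_extension e s"
proof (cases "s < e")
  case True
  assume e: "0 < e"
  have "positive_extension e s = (s\<^sup>2 + e\<^sup>2) / (2 * e)"
    using True e by (simp add: positive_extension_def field_simps power2_eq_square)
  then show ?thesis using e by (simp add: add_nonneg_pos)
qed (simp add: positive_extension_def)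

lemma positive_extension_eq: "e \<le> s \<Longrightarrow> positive_extension e s = s"
  by (simp add: positive_extension_def)

text \<open>Below \<open>e\<close> the function is the parabola
  \<open>(s * s + e * e) / (2 * e)\<close>, whose slope \<open>s / e\<close> reaches 1 exactly at
  \<open>e\<close>.\<close>

lemma DERIV_positive_extension:
  assumes e: "0 < e" shows "(positive_extension e has_real_derivative min (s / e) 1) (at s)"
proof -
  have "((\<lambda>s. (min (s - e) 0)\<^sup>2) has_real_derivative 2 * min (s - e) 0 * 1) (at s)"
    by (rule DERIV_chain2[OF DERIV_min_zero_square]) (auto intro!: derivative_eq_intros)
  then have "(positive_extension e has_real_derivative 1 + 2 * min (s - e) 0 / (2 * e)) (at s)"
    unfolding positive_extension_def[abs_def] by (intro DERIV_add DERIV_ident DERIV_cdivide) simp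
  moreover have "1 + 2 * min (s - e) 0 / (2 * e) = min (s / e) 1"
    using e by (auto simp: min_def field_simps)
  ultimately show ?thesis by simp
qed

lemma tendsto_positive_extension:
  assumes "0 < e" "(u \<longlongrightarrow> s) F" shows "((\<lambda>n. positive_extension e (u n)) \<longlongrightarrow> positive_extension e s) F"
  using isCont_tendsto_compose[OF DERIV_isCont[OF DERIV_positive_extension[OF assms(1)]] assms(2)] .

text \<open>A global variant of \<open>C1_Rn\<close> that includes continuity of the function and
  keeps the partial derivatives explicit: the algebra to which Stone-Weierstrass is applied.\<close>

definition C1_UNIV :: "nat \<Rightarrow> ((nat \<Rightarrow> real) \<Rightarrow> real) \<Rightarrow> (nat \<Rightarrow> (nat \<Rightarrow> real) \<Rightarrow> real) \<Rightarrow> bool" where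
  "C1_UNIV m F DF \<longleftrightarrow> continuous_on UNIV F \<and> (\<forall>i<m. continuous_on UNIV (DF i) \<and>
     (\<forall>v. ((\<lambda>t. F (v(i := v i + t))) has_real_derivative DF i v) (at 0)))"

lemma C1_UNIV_const: "C1_UNIV m (\<lambda>_. c) (\<lambda>_ _. 0)"
  by (auto simp: C1_UNIV_def)

lemma C1_UNIV_coordinate: "C1_UNIV m (\<lambda>v. v j) (\<lambda>i _. if i = j then 1 else 0)"
  unfolding C1_UNIV_def
proof (intro conjI allI impI)
  fix i :: nat and v :: "nat \<Rightarrow> real"
  show "((\<lambda>t. (v(i := v i + t)) j) has_real_derivative (if i = j then 1 else 0)) (at 0)"
    by (cases "i = j") (auto intro!: derivative_eq_intros)
qed auto

lemma C1_UNIV_add: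
  assumes "C1_UNIV m F DF" "C1_UNIV m G DG"
  shows "C1_UNIV m (\<lambda>v. F v + G v) (\<lambda>i v. DF i v + DG i v)"
  using assms unfolding C1_UNIV_def by (auto intro!: continuous_intros derivative_intros)

lemma C1_UNIV_mult:
  assumes F: "C1_UNIV m F DF" and G: "C1_UNIV m G DG"
  shows "C1_UNIV m (\<lambda>v. F v * G v) (\<lambda>i v. DF i v * G v + DG i v * F v)"
  unfolding C1_UNIV_def
proof (intro conjI allI impI)
  fix i v assume "i < m"
  then have "((\<lambda>t. F (v(i := v i + t)) * G (v(i := v i + t))) has_real_derivative
      DF i v * G (v(i := v i + 0)) + DG i v * F (v(i := v i + 0))) (at 0)"
    using F G unfolding C1_UNIV_def by (intro DERIV_mult) auto
  then show "((\<lambda>t. F (v(i := v i + t)) * G (v(i := v i + t))) has_real_derivative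
      DF i v * G v + DG i v * F v) (at 0)" by simp
qed (use F G in \<open>auto simp: C1_UNIV_def intro!: continuous_intros\<close>)

lemma C1_UNIV_sum:
  assumes "finite I" "\<And>j. j \<in> I \<Longrightarrow> C1_UNIV m (F j) (DF j)"
  shows "C1_UNIV m (\<lambda>v. \<Sum>j\<in>I. F j v) (\<lambda>i v. \<Sum>j\<in>I. DF j i v)"
  using assms
proof (induction I rule: finite_induct)
  case empty
  then show ?case using C1_UNIV_const[of m 0] by simp
next
  case (insert j I)
  then show ?case using C1_UNIV_add[of m "F j" "DF j" "\<lambda>v. \<Sum>j\<in>I. F j v" "\<lambda>i v. \<Sum>j\<in>I. DF j i v"] by simp
qed

definition unit_cube :: "nat \<Rightarrow> (nat \<Rightarrow> real) set" where
  "unit_cube m = {v. \<forall>i. v i \<in> (if i < m then {0..1} else {0})}"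

lemma compact_unit_cube: "compact (unit_cube m)"
proof -
  have "compactin (product_topology (\<lambda>i::nat. euclidean) UNIV) (PiE UNIV (\<lambda>i. if i < m then {0..1} else {0::real}))"
    by (subst compactin_PiE) (auto simp: compactin_euclidean_iff)
  moreover have "PiE UNIV (\<lambda>i. if i < m then {0..1} else {0::real}) = unit_cube m"
    by (auto simp: unit_cube_def PiE_def Pi_def)
  ultimately show ?thesis by (simp add: euclidean_product_topology compactin_euclidean_iff)
qed

text \<open>Stone-Weierstrass on the cube, with the coordinates separating points. Weight vectors of
  quantizations, padded by zeros, lie in this cube.\<close>

lemma C1_UNIV_approximation:
  assumes c: "continuous_on UNIV c" and e: "0 < e"
  shows "\<exists>g Dg. C1_UNIV m g Dg \<and> (\<forall>v\<in>unit_cube m. \<bar>c v - g v\<bar> < e)"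
proof -
  let ?P = "\<lambda>g. \<exists>Dg. C1_UNIV m g Dg"
  have "\<exists>g. ?P g \<and> (\<forall>v\<in>unit_cube m. \<bar>c v - g v\<bar> < e)"
  proof (rule Stone_Weierstrass_HOL[OF compact_unit_cube _ _ _ _ _ continuous_on_subset[OF c subset_UNIV] e])
    show "?P (\<lambda>_. r)" for r using C1_UNIV_const by blast
    show "continuous_on (unit_cube m) g" if "?P g" for g
      using that unfolding C1_UNIV_def by (auto intro: continuous_on_subset)
    show "?P (\<lambda>v. g v + h v)" if "?P g \<and> ?P h" for g h using that C1_UNIV_add by blast
    show "?P (\<lambda>v. g v * h v)" if "?P g \<and> ?P h" for g h using that C1_UNIV_mult by blast
    show "\<exists>g. ?P g \<and> g x \<noteq> g y" if "x \<in> unit_cube m \<and> y \<in> unit_cube m \<and> x \<noteq> y" for x y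
    proof -
      from that have "x \<noteq> y" by blast
      then obtain j where "x j \<noteq> y j" by blast
      then show ?thesis using C1_UNIV_coordinate[of m j] by (intro exI[of _ "\<lambda>v. v j"]) blast
    qed
  qed
  then show ?thesis by blast
qed

section \<open>Probability measures attached to arbitrary weight vectors\<close>

lemma discrete_measure_cong:
  assumes "\<And>i. i < m \<Longrightarrow> w i = w' i" shows "discrete_measure m xs w = discrete_measure m xs w'"
proof -
  have "point_measure {..<m} (\<lambda>i. ennreal (w i)) = point_measure {..<m} (\<lambda>i. ennreal (w' i))"
    unfolding point_measure_def by (rule density_cong) (use assms in \<open>auto simp: AE_count_space\<close>)
  then show ?thesis by (simp add: discrete_measure_def)
qed

lemma continuous_on_UNIV_componentwiseI:
  fixes F :: "(nat \<Rightarrow> real) \<Rightarrow> real"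
  assumes "\<And>V v. (\<And>i. (\<lambda>n::nat. V n i) \<longlonglongrightarrow> v i) \<Longrightarrow> (\<lambda>n. F (V n)) \<longlonglongrightarrow> F v"
  shows "continuous_on UNIV F"
  unfolding continuous_on_sequentially o_def
proof (intro allI ballI impI)
  fix V :: "nat \<Rightarrow> nat \<Rightarrow> real" and v assume "(\<forall>n. V n \<in> UNIV) \<and> V \<longlonglongrightarrow> v"
  then have "(\<lambda>n. V n i) \<longlonglongrightarrow> v i" for i
    using continuous_on_tendsto_compose[OF continuous_on_product_coordinates[of i], of V v] by simp
  then show "(\<lambda>n. F (V n)) \<longlonglongrightarrow> F v" by (rule assms)
qed

definition extended_total :: "nat \<Rightarrow> real \<Rightarrow> (nat \<Rightarrow> real) \<Rightarrow> real" where
  "extended_total m e v = (\<Sum>j<m. positive_extension e (v j))"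

definition extended_weight :: "nat \<Rightarrow> real \<Rightarrow> (nat \<Rightarrow> real) \<Rightarrow> nat \<Rightarrow> real" where
  "extended_weight m e v i = positive_extension e (v i) / extended_total m e v"

text \<open>For positive \<open>m\<close> and \<open>e\<close> this belongs to \<open>Pp p\<close>
  for every real vector \<open>v\<close>, so \<open>f\<close> can be composed with it on the whole
  space. At weights that are at least \<open>e\<close> and sum to 1, neither clipping nor
  normalization changes anything.\<close>

definition extended_measure :: "nat \<Rightarrow> (nat \<Rightarrow> 'a::euclidean_space) \<Rightarrow> real \<Rightarrow> (nat \<Rightarrow> real) \<Rightarrow> 'a measure" where
  "extended_measure m xs e v = discrete_measure m xs (extended_weight m e v)"

context C1_function begin

context
  fixes m :: nat and xs :: "nat \<Rightarrow> 'a" and e :: real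
  assumes m: "0 < m" and e: "0 < e"
begin

lemma extended_total_pos: "0 < extended_total m e v"
  unfolding extended_total_def using m positive_extension_pos[OF e] by (intro sum_pos) auto

lemma extended_weight_nonneg: "0 \<le> extended_weight m e v i"
  unfolding extended_weight_def using extended_total_pos positive_extension_pos[OF e] by (simp add: less_imp_le)

lemma extended_weight_sum: "(\<Sum>i<m. extended_weight m e v i) = 1"
  unfolding extended_weight_def sum_divide_distrib[symmetric] extended_total_def[symmetric] using extended_total_pos[of v] by simp

lemma extended_measure_Pp: "extended_measure m xs e v \<in> Pp p"
  unfolding extended_measure_def by (intro discrete_measure_Pp[OF _ _ p] extended_weight_nonneg extended_weight_sum)

lemma integral_extended_measure:
  "\<phi> \<in> borel_measurable borel \<Longrightarrow> integ (extended_measure m xs e v) \<phi> = (\<Sum>i<m. extended_weight m e v i * \<phi> (xs i))"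
  unfolding extended_measure_def by (intro integral_discrete_measure extended_weight_nonneg)

lemma extended_total_tendsto:
  assumes "\<And>i. i < m \<Longrightarrow> (\<lambda>n. V n i) \<longlonglongrightarrow> v i" shows "(\<lambda>n. extended_total m e (V n)) \<longlonglongrightarrow> extended_total m e v"
  unfolding extended_total_def by (intro tendsto_sum tendsto_positive_extension[OF e] assms) auto

lemma extended_weight_tendsto:
  assumes "\<And>i. i < m \<Longrightarrow> (\<lambda>n. V n i) \<longlonglongrightarrow> v i" "i < m" shows "(\<lambda>n. extended_weight m e (V n) i) \<longlonglongrightarrow> extended_weight m e v i"
  unfolding extended_weight_def using extended_total_pos[of v]
  by (intro tendsto_divide tendsto_positive_extension[OF e] assms extended_total_tendsto) auto

lemma extended_measure_pweak:
  assumes "\<And>i. i < m \<Longrightarrow> (\<lambda>n. V n i) \<longlonglongrightarrow> v i"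
  shows "pweak p (\<lambda>n. extended_measure m xs e (V n)) (extended_measure m xs e v)"
  unfolding pweak_def
  by (auto simp: integral_extended_measure[OF pgrowth_measurable] intro!: tendsto_sum tendsto_mult extended_weight_tendsto assms)

lemma continuous_extended_total: "continuous_on UNIV (extended_total m e)"
  by (intro continuous_on_UNIV_componentwiseI extended_total_tendsto)

lemma continuous_D_extended_measure: "continuous_on UNIV (\<lambda>v. D x (extended_measure m xs e v))"
  by (intro continuous_on_UNIV_componentwiseI D_tendsto extended_measure_Pp extended_measure_pweak tendsto_const)

lemma continuous_mean_D: "continuous_on UNIV (\<lambda>v. integ (extended_measure m xs e v) (\<lambda>z. D z (extended_measure m xs e v)))"
  by (intro continuous_on_UNIV_componentwiseI integral_D_tendsto extended_measure_Pp extended_measure_pweak)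

text \<open>Normalization makes a change of one coordinate move the measure along the segment
  towards the atom \<open>xs i\<close>: with total \<open>T\<close> and unnormalized integral
  \<open>X\<close>, it is the identity expressing
  \<open>(X + a * \<phi> (xs i)) / (T + a) - X / T\<close>. This is the hypothesis of
  \<open>f_increment_towards_point\<close>.\<close>

lemma extended_measure_increment:
  assumes i: "i < m" and \<phi>: "\<phi> \<in> borel_measurable borel"
    and a: "a = positive_extension e s - positive_extension e (v i)"
  shows "integ (extended_measure m xs e (v(i := s))) \<phi> - integ (extended_measure m xs e v) \<phi> = a / (extended_total m e v + a) * (\<phi> (xs i) - integ (extended_measure m xs e v) \<phi>)"
proof -
  let ?h = "\<lambda>j. positive_extension e (v j)"
  define X where "X = (\<Sum>j<m. ?h j * \<phi> (xs j))"
  have h': "positive_extension e ((v(i := s)) j) = ?h j + (if j = i then a else 0)" for j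
    using a by simp
  have t: "extended_total m e (v(i := s)) = extended_total m e v + a"
    unfolding extended_total_def h' using i by (simp add: sum.distrib)
  have X': "(\<Sum>j<m. positive_extension e ((v(i := s)) j) * \<phi> (xs j)) = X + a * \<phi> (xs i)"
  proof -
    have "(\<Sum>j<m. positive_extension e ((v(i := s)) j) * \<phi> (xs j))
        = (\<Sum>j<m. ?h j * \<phi> (xs j) + (if j = i then a * \<phi> (xs j) else 0))"
      unfolding h' by (intro sum.cong) (auto simp: distrib_right)
    then show ?thesis using i by (simp add: sum.distrib X_def)
  qed
  have I: "integ (extended_measure m xs e w) \<phi> = (\<Sum>j<m. positive_extension e (w j) * \<phi> (xs j)) / extended_total m e w" for w
    unfolding integral_extended_measure[OF \<phi>] extended_weight_def by (simp add: sum_divide_distrib)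
  have pos: "0 < extended_total m e v" "0 < extended_total m e v + a" using extended_total_pos[of v] extended_total_pos[of "v(i := s)"] t by auto
  show ?thesis
    unfolding I[of "v(i := s)"] I[of v] X' t X_def[symmetric]
    using pos by (simp add: field_simps)
qed

text \<open>The difference quotient factors into that of the clipping function, the reciprocal of
  the new total, and an averaged centred derivative; each factor has a limit.\<close>

lemma DERIV_f_extended_measure:
  assumes i: "i < m"
  shows "((\<lambda>t. f (extended_measure m xs e (v(i := v i + t)))) has_real_derivative
      min (v i / e) 1 / extended_total m e v * (D (xs i) (extended_measure m xs e v) - integ (extended_measure m xs e v) (\<lambda>z. D z (extended_measure m xs e v)))) (at 0)"
  unfolding DERIV_def LIMSEQ_SEQ_conv[symmetric]
proof (intro allI impI)
  fix S :: "nat \<Rightarrow> real" assume "(\<forall>n. S n \<noteq> 0) \<and> S \<longlonglongrightarrow> 0"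
  then have S: "\<And>n. S n \<noteq> 0" "S \<longlonglongrightarrow> 0" by auto
  define a where "a n = positive_extension e (v i + S n) - positive_extension e (v i)" for n
  define s where "s n = a n / (extended_total m e v + a n)" for n
  have Slim: "(\<lambda>n. v i + S n) \<longlonglongrightarrow> v i" using tendsto_add[OF tendsto_const S(2)] by simp
  have w: "pweak p (\<lambda>n. extended_measure m xs e (v(i := v i + S n))) (extended_measure m xs e v)"
  proof (rule extended_measure_pweak)
    show "(\<lambda>n. (v(i := v i + S n)) j) \<longlonglongrightarrow> v j" for j
      using Slim by (cases "j = i") auto
  qed
  obtain J where J: "\<And>n. f (extended_measure m xs e (v(i := v i + S n))) - f (extended_measure m xs e v) = s n * J n"
      and Jlim: "J \<longlonglongrightarrow> D (xs i) (extended_measure m xs e v) - integ (extended_measure m xs e v) (\<lambda>z. D z (extended_measure m xs e v))"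
    using f_increment_towards_point[OF extended_measure_Pp extended_measure_Pp w, of s "xs i"]
      extended_measure_increment[where v = v and a = "a n" and s = "v i + S n" for n, OF i pgrowth_measurable a_def]
    unfolding s_def by blast
  have alim: "a \<longlonglongrightarrow> 0"
    unfolding a_def using tendsto_diff[OF tendsto_positive_extension[OF e Slim] tendsto_const[of "positive_extension e (v i)"]] by simp
  have "(\<lambda>n. a n / S n) \<longlonglongrightarrow> min (v i / e) 1"
    using DERIV_positive_extension[OF e, of "v i"] S unfolding DERIV_def LIMSEQ_SEQ_conv[symmetric] a_def by blast
  then have "(\<lambda>n. a n / S n / (extended_total m e v + a n) * J n) \<longlonglongrightarrow> min (v i / e) 1 / (extended_total m e v + 0) * (D (xs i) (extended_measure m xs e v) - integ (extended_measure m xs e v) (\<lambda>z. D z (extended_measure m xs e v)))"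
    using extended_total_pos[of v] by (intro tendsto_intros alim Jlim) auto
  moreover have "(f (extended_measure m xs e (v(i := v i + (0 + S n)))) - f (extended_measure m xs e (v(i := v i + 0)))) / S n = a n / S n / (extended_total m e v + a n) * J n" for n
    using J[of n] by (simp add: s_def)
  ultimately show "(\<lambda>n. (f (extended_measure m xs e (v(i := v i + (0 + S n)))) - f (extended_measure m xs e (v(i := v i + 0)))) / S n)
      \<longlonglongrightarrow> min (v i / e) 1 / extended_total m e v * (D (xs i) (extended_measure m xs e v) - integ (extended_measure m xs e v) (\<lambda>z. D z (extended_measure m xs e v)))" by simp
qed

end

text \<open>The value is exact and only the derivative carries an error. It is the same constant
  \<open>g - c\<close> in each coefficient, and since the \<open>\<psi> i\<close> sum to 1 it does
  not grow with \<open>x\<close>.\<close>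

lemma cylinder_approximation:
  assumes q: "quantizer p R m xs \<psi> e" and eta: "0 < \<eta>"
  shows "\<exists>g Dg. cylinder g Dg \<and> (\<forall>M\<in>Pp p. g M = f (quant m xs \<psi> M) \<and>
    (\<forall>x. \<bar>Dg x M - qavg m xs \<psi> (\<lambda>z. D z (quant m xs \<psi> M)) x\<bar> \<le> \<eta>))"
proof -
  note m = quantizerD(2)[OF q] and e = quantizerD(3)[OF q]
  define \<mu> where "\<mu> = extended_measure m xs e"
  define T where "T = extended_total m e"
  define c where "c v = integ (extended_measure m xs e v) (\<lambda>z. D z (extended_measure m xs e v))" for v
  obtain g Dg where g: "C1_UNIV m g Dg" and gc: "\<And>v. v \<in> unit_cube m \<Longrightarrow> \<bar>c v - g v\<bar> < \<eta>"
    using C1_UNIV_approximation[OF continuous_mean_D[OF m e] eta] unfolding c_def by blast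
  have "C1_UNIV m (\<lambda>v. (\<Sum>j<m. v j) + (-1)) (\<lambda>i v. (\<Sum>j<m. if i = j then 1 else 0) + 0)"
    by (intro C1_UNIV_add C1_UNIV_sum C1_UNIV_coordinate C1_UNIV_const) simp
  from C1_UNIV_mult[OF this g]
  have G: "C1_UNIV m (\<lambda>v. ((\<Sum>j<m. v j) + (-1)) * g v)
      (\<lambda>i v. ((\<Sum>j<m. if i = j then 1 else 0) + 0) * g v + Dg i v * ((\<Sum>j<m. v j) + (-1)))" .
  \<comment> \<open>On the hyperplane of total mass 1 the second summand vanishes and has gradient \<open>g v * (1, \<dots>, 1)\<close>.\<close>
  define F where "F v = f (\<mu> v) + ((\<Sum>j<m. v j) + (-1)) * g v" for v
  \<comment> \<open>The indicator sum plus 0 equals 1 for \<open>i < m\<close>; it is kept in the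
    form in which the closure rules for \<open>C1_UNIV\<close> deliver it.\<close>
  define DF where "DF i v = min (v i / e) 1 / T v * (D (xs i) (\<mu> v) - c v)
      + (((\<Sum>j<m. if i = j then 1 else 0) + 0) * g v + Dg i v * ((\<Sum>j<m. v j) + (-1)))" for i v
  have C: "C1_Rn m F DF"
    unfolding C1_Rn_def
  proof (intro conjI allI impI ballI)
    fix i assume i: "i < m"
    have "continuous_on UNIV (DF i)"
      unfolding DF_def T_def \<mu>_def c_def
    proof (intro continuous_on_add[of UNIV "\<lambda>v. min (v i / e) 1 / _ v * _ v"])
      have "continuous_on UNIV (\<lambda>v::nat \<Rightarrow> real. min (v i / e) 1)"
        using e by (intro continuous_intros) auto
      then show "continuous_on UNIV (\<lambda>v. min (v i / e) 1 / extended_total m e v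
          * (D (xs i) (extended_measure m xs e v) - integ (extended_measure m xs e v) (\<lambda>z. D z (extended_measure m xs e v))))"
        using extended_total_pos[OF m e]
        by (intro continuous_on_mult continuous_on_divide continuous_on_diff continuous_extended_total[OF m e]
              continuous_D_extended_measure[OF m e] continuous_mean_D[OF m e]) (auto simp: less_imp_neq[symmetric])
    qed (use G i in \<open>auto simp only: C1_UNIV_def\<close>)
    then show "continuous_on (Rn m) (DF i)" by (rule continuous_on_subset) simp
    fix v
    show "((\<lambda>t. F (v(i := v i + t))) has_real_derivative DF i v) (at 0)"
      unfolding F_def DF_def
    proof (rule DERIV_add)
      show "((\<lambda>t. f (\<mu> (v(i := v i + t)))) has_real_derivative
          min (v i / e) 1 / T v * (D (xs i) (\<mu> v) - c v)) (at 0)"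
        unfolding T_def \<mu>_def c_def by (rule DERIV_f_extended_measure[OF m e i])
    qed (use G i in \<open>auto simp only: C1_UNIV_def\<close>)
  qed
  define pt where "pt M j = (if j < m then integ M (\<psi> j) else 0)" for M j
  define h where "h M = F (pt M)" for M
  define Dh where "Dh x M = (\<Sum>i<m. DF i (pt M) * \<psi> i x)" for x M
  have "bcont (\<psi> i)" if "i < m" for i
    unfolding bcont_def bounded_iff
    using quantizerD(4)[OF q that] quantizerD(6,10)[OF q that] by (auto intro!: exI[of _ 1] simp: abs_of_pos)
  then have "cylinder h Dh"
    unfolding cylinder_def using C m
    by (intro exI[of _ m] exI[of _ F] exI[of _ DF] exI[of _ \<psi>]) (auto simp: h_def Dh_def pt_def[abs_def])
  moreover have "h M = f (quant m xs \<psi> M) \<and>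
      (\<forall>x. \<bar>Dh x M - qavg m xs \<psi> (\<lambda>z. D z (quant m xs \<psi> M)) x\<bar> \<le> \<eta>)" if M: "M \<in> Pp p" for M
  proof -
    note wts = quantizer_weights[OF q M]
    have s1: "(\<Sum>j<m. pt M j) = 1" using wts(1) by (simp add: pt_def)
    have pe: "positive_extension e (pt M j) = integ M (\<psi> j)" if "j < m" for j
      using wts(2)[OF that] that by (simp add: pt_def positive_extension_eq)
    have T1: "T (pt M) = 1" unfolding T_def extended_total_def using pe wts(1) by simp
    have mq: "\<mu> (pt M) = quant m xs \<psi> M"
      unfolding \<mu>_def extended_measure_def quant_def
      by (rule discrete_measure_cong) (use pe T1 in \<open>simp add: extended_weight_def T_def\<close>)
    have "pt M \<in> unit_cube m"
      using wts(3,4) by (auto simp: unit_cube_def pt_def intro: less_imp_le)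
    then have close: "\<bar>c (pt M) - g (pt M)\<bar> \<le> \<eta>" using gc by (simp add: less_imp_le)
    \<comment> \<open>At a weight vector the slope and the total are 1, so the first summand is
      \<open>D\<close> minus its mean \<open>c\<close>. The factor of \<open>Dg\<close> vanishes and
      \<open>g\<close> remains, cancelling \<open>c\<close> up to the approximation error.\<close>
    have DFi: "DF i (pt M) = D (xs i) (quant m xs \<psi> M) + (g (pt M) - c (pt M))" if "i < m" for i
    proof -
      have "min (pt M i / e) 1 = 1" using wts(2)[OF that] that e by (simp add: pt_def min_def field_simps)
      then show ?thesis using that by (simp add: DF_def T1 mq s1)
    qed
    have "Dh x M = qavg m xs \<psi> (\<lambda>z. D z (quant m xs \<psi> M)) x + (g (pt M) - c (pt M))" for x
    proof -
      have "Dh x M = (\<Sum>i<m. \<psi> i x * D (xs i) (quant m xs \<psi> M) + \<psi> i x * (g (pt M) - c (pt M)))"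
        unfolding Dh_def by (intro sum.cong) (auto simp: DFi algebra_simps)
      also have "\<dots> = qavg m xs \<psi> (\<lambda>z. D z (quant m xs \<psi> M)) x + (g (pt M) - c (pt M))"
        using quantizerD(8)[OF q, of x] by (simp add: sum.distrib qavg_def sum_distrib_right[symmetric])
      finally show ?thesis .
    qed
    then show ?thesis using close by (simp add: h_def F_def mq s1)
  qed
  ultimately show ?thesis by blast
qed

end

section \<open>The approximating sequence and its bounds\<close>

theorem theorem4p4:
  fixes f :: "'a::euclidean_space measure \<Rightarrow> real" and D :: "'a \<Rightarrow> 'a measure \<Rightarrow> real"
    and p :: real
  assumes "p = 0 \<or> p \<ge> 1"
    and "C1_version p f D"
  shows "\<exists>fs Ds. (\<forall>k::nat. cylinder (fs k) (Ds k)) \<and>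
    (\<forall>M\<in>Pp p. (\<lambda>k. fs k M) \<longlonglongrightarrow> f M) \<and>
    (\<forall>M\<in>Pp p. \<forall>x. (\<lambda>k. Ds k x M) \<longlonglongrightarrow> D x M) \<and>
    (\<forall>K. Pcompact p K \<longrightarrow> (\<exists>c. \<forall>M\<in>K. \<forall>x. \<forall>k.
        \<bar>fs k M\<bar> \<le> c \<and> \<bar>Ds k x M\<bar> \<le> c * (1 + pw x p)))"
proof -
  interpret C1_function p f D using assms by unfold_locales
  \<comment> \<open>The radius is \<open>Suc k\<close> because a quantizer requires
    \<open>1 \<le> R\<close>.\<close>
  have "\<forall>k::nat. \<exists>m xs \<psi> \<epsilon>. quantizer p (real (Suc k)) m (xs :: nat \<Rightarrow> 'a) \<psi> \<epsilon>"
    by (intro allI quantizer_exists) simp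
  then obtain m xs \<psi> \<epsilon> where q: "\<And>k::nat. quantizer p (real (Suc k)) (m k) (xs k :: nat \<Rightarrow> 'a) (\<psi> k) (\<epsilon> k)"
    by metis
  let ?T = "\<lambda>k. quant (m k) (xs k) (\<psi> k)" and ?A = "\<lambda>k. qavg (m k) (xs k) (\<psi> k)"
  have "\<exists>g Dg. cylinder g Dg \<and> (\<forall>M\<in>Pp p. g M = f (?T k M) \<and>
      (\<forall>x. \<bar>Dg x M - ?A k (\<lambda>z. D z (?T k M)) x\<bar> \<le> inverse (real (Suc k))))" for k
    by (rule cylinder_approximation[OF q]) simp
  then obtain fs Ds where cyl: "\<And>k. cylinder (fs k) (Ds k)"
    and fs: "\<And>k M. M \<in> Pp p \<Longrightarrow> fs k M = f (?T k M)"
    and Ds: "\<And>k M x. M \<in> Pp p \<Longrightarrow> \<bar>Ds k x M - ?A k (\<lambda>z. D z (?T k M)) x\<bar> \<le> inverse (real (Suc k))"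
    by metis
  show ?thesis
  proof (intro exI[of _ fs] exI[of _ Ds] conjI allI ballI impI cyl)
    fix M :: "'a measure" assume M: "M \<in> Pp p"
    show "(\<lambda>k. fs k M) \<longlonglongrightarrow> f M" using quant_f_tendsto[OF q M] fs[OF M] by simp
    fix x
    have "(\<lambda>k. Ds k x M - ?A k (\<lambda>z. D z (?T k M)) x) \<longlonglongrightarrow> 0"
      by (rule Lim_null_comparison[OF _ LIMSEQ_inverse_real_of_nat]) (use Ds[OF M] in auto)
    from tendsto_add[OF this quant_D_tendsto[OF q M, of x]]
    show "(\<lambda>k. Ds k x M) \<longlonglongrightarrow> D x M" by simp
  next
    fix K :: "'a measure set" assume K: "Pcompact p K"
    obtain c1 where c1: "\<And>M k. M \<in> K \<Longrightarrow> \<bar>f (?T k M)\<bar> \<le> c1"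
      using quant_f_bounded[OF q K] by blast
    obtain c2 where c2: "\<And>M k x. M \<in> K \<Longrightarrow> \<bar>D x (?T k M)\<bar> \<le> c2 * (1 + pw x p)"
      using quant_D_bounded[OF q K] by blast
    \<comment> \<open>The factor \<open>2 + 2 powr p\<close> is the price of averaging in
      \<open>qavg_growth\<close>; the added 1 absorbs the derivative error, which is at most 1 at
      every level.\<close>
    define c where "c = max c1 (c2 * (2 + 2 powr p) + 1)"
    show "\<exists>c. \<forall>M\<in>K. \<forall>x k. \<bar>fs k M\<bar> \<le> c \<and> \<bar>Ds k x M\<bar> \<le> c * (1 + pw x p)"
    proof (intro exI[of _ c] ballI allI conjI)
      fix M :: "'a measure" and x k assume MK: "M \<in> K"
      then have M: "M \<in> Pp p" using K unfolding Pcompact_def by blast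
      show "\<bar>fs k M\<bar> \<le> c" using c1[OF MK, of k] fs[OF M] by (simp add: c_def)
      have "\<bar>?A k (\<lambda>z. D z (?T k M)) x\<bar> \<le> c2 * (2 + 2 powr p) * (1 + pw x p)"
        by (rule qavg_growth[OF p q c2[OF MK]])
      moreover have "inverse (real (Suc k)) \<le> 1 * (1 + pw x p)"
        by (simp add: inverse_eq_divide add_increasing2)
      ultimately have "\<bar>Ds k x M\<bar> \<le> (c2 * (2 + 2 powr p) + 1) * (1 + pw x p)"
        using Ds[OF M, of k x] unfolding distrib_right[of "c2 * (2 + 2 powr p)" 1] by linarith
      also have "\<dots> \<le> c * (1 + pw x p)" by (intro mult_right_mono) (auto simp: c_def less_imp_le)
      finally show "\<bar>Ds k x M\<bar> \<le> c * (1 + pw x p)" .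
    qed
  qed
qed

end
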